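(* Let $p,q\in[1,\infty)$ be such that $q>\max\{2,p\}$. Then any uniformly continuous map $f:\ell_q\to\ell_p$ (respectively, any uniformly continuous map $f:L_q\to L_p$) satisfies $$\sup_{t>0}\ \inf_{\|x-y\|=t}\|f(x)-f(y)\|=0,$$ where for each $t>0$ the infimum is over all pairs $x,y$ in the domain of $f$ with $\|x-y\|=t$.
   Context: All Banach spaces are over the reals. $\ell_p=\ell_p(\mathbb{N})$ and $L_p=L_p[0,1]$ with their usual norms. *)

theory Defs
  imports "HOL-Analysis.Analysis"
begin

section \<open>Minkowski's inequality\<close>

lemma powr_convex_nonneg:
  fixes p s t u v :: real
  assumes p: "p \<ge> 1" and st: "s \<ge> 0" "t \<ge> 0" "s + t = 1" and uv: "u \<ge> 0" "v \<ge> 0"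
  shows "(s * u + t * v) powr p \<le> s * u powr p + t * v powr p"
proof -
  have shrink: "r powr p \<le> r" if "0 \<le> r" "r \<le> 1" for r :: real
  proof (cases "r = 0")
    case False
    then show ?thesis using powr_mono'[of 1 p r] that p by simp
  qed (use p in simp)
  consider "u = 0" | "v = 0" | "u > 0" "v > 0" using uv by linarith
  then show ?thesis
  proof cases
    case 1
    then show ?thesis using shrink[of t] st uv p
      by (simp add: powr_mult mult_right_mono)
  next
    case 2
    then show ?thesis using shrink[of s] st uv p
      by (simp add: powr_mult mult_right_mono)
  next
    case 3
    then show ?thesis using powr_convex[OF p] st
      by (auto simp: convex_on_def)
  qed
qed

lemma powr_abs_add_bound:
  fixes p x y a b :: real
  assumes p: "p \<ge> 1" and ab: "a > 0" "b > 0"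
  shows "\<bar>x + y\<bar> powr p \<le> (a + b) powr p *
           (a / (a + b) * (\<bar>x\<bar> powr p / a powr p) + b / (a + b) * (\<bar>y\<bar> powr p / b powr p))"
proof -
  have eq: "\<bar>x\<bar> + \<bar>y\<bar> = (a + b) * (a / (a + b) * (\<bar>x\<bar> / a) + b / (a + b) * (\<bar>y\<bar> / b))"
  proof -
    have "a / (a + b) * (\<bar>x\<bar> / a) + b / (a + b) * (\<bar>y\<bar> / b) = (\<bar>x\<bar> + \<bar>y\<bar>) / (a + b)"
      using ab by (simp add: add_divide_distrib)
    then show ?thesis using ab by simp
  qed
  have "\<bar>x + y\<bar> powr p \<le> (\<bar>x\<bar> + \<bar>y\<bar>) powr p"
    using p by (intro powr_mono2) auto
  also have "\<dots> = (a + b) powr p * (a / (a + b) * (\<bar>x\<bar> / a) + b / (a + b) * (\<bar>y\<bar> / b)) powr p"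
    unfolding eq using ab by (subst powr_mult) auto
  also have "\<dots> \<le> (a + b) powr p *
      (a / (a + b) * (\<bar>x\<bar> / a) powr p + b / (a + b) * (\<bar>y\<bar> / b) powr p)"
    using ab p by (intro mult_left_mono powr_convex_nonneg) (auto simp flip: add_divide_distrib)
  also have "\<dots> = (a + b) powr p *
      (a / (a + b) * (\<bar>x\<bar> powr p / a powr p) + b / (a + b) * (\<bar>y\<bar> powr p / b powr p))"
    using ab by (simp add: powr_divide)
  finally show ?thesis .
qed

lemma integrable_powr_abs_add:
  fixes f g :: "'a \<Rightarrow> real"
  assumes p: "p \<ge> 1" and [measurable]: "f \<in> borel_measurable M" "g \<in> borel_measurable M"
    and f: "integrable M (\<lambda>x. \<bar>f x\<bar> powr p)" and g: "integrable M (\<lambda>x. \<bar>g x\<bar> powr p)"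
  shows "integrable M (\<lambda>x. \<bar>f x + g x\<bar> powr p)"
proof (rule Bochner_Integration.integrable_bound)
  show "integrable M (\<lambda>x. 2 powr p * (1 / 2 * (\<bar>f x\<bar> powr p) + 1 / 2 * (\<bar>g x\<bar> powr p)))"
    using f g by simp
  show "AE x in M. norm (\<bar>f x + g x\<bar> powr p) \<le>
      norm (2 powr p * (1 / 2 * (\<bar>f x\<bar> powr p) + 1 / 2 * (\<bar>g x\<bar> powr p)))"
    using powr_abs_add_bound[OF p, of 1 1] by simp
qed measurable

lemma Minkowski_integral:
  fixes f g :: "'a \<Rightarrow> real"
  assumes p: "p \<ge> 1" and [measurable]: "f \<in> borel_measurable M" "g \<in> borel_measurable M"
    and f: "integrable M (\<lambda>x. \<bar>f x\<bar> powr p)" and g: "integrable M (\<lambda>x. \<bar>g x\<bar> powr p)"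
  shows "(\<integral>x. \<bar>f x + g x\<bar> powr p \<partial>M) powr (1 / p)
       \<le> (\<integral>x. \<bar>f x\<bar> powr p \<partial>M) powr (1 / p) + (\<integral>x. \<bar>g x\<bar> powr p \<partial>M) powr (1 / p)"
proof -
  define A where "A = (\<integral>x. \<bar>f x\<bar> powr p \<partial>M)"
  define B where "B = (\<integral>x. \<bar>g x\<bar> powr p \<partial>M)"
  have A0: "A \<ge> 0" and B0: "B \<ge> 0" by (simp_all add: A_def B_def)
  consider "A = 0" | "B = 0" | "A > 0" "B > 0" using A0 B0 by linarith
  then have "(\<integral>x. \<bar>f x + g x\<bar> powr p \<partial>M) powr (1 / p) \<le> A powr (1 / p) + B powr (1 / p)"
  proof cases
    case 1
    then have "AE x in M. f x = 0"
      using integral_nonneg_eq_0_iff_AE[OF f] by (auto simp: A_def)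
    then have "(\<integral>x. \<bar>f x + g x\<bar> powr p \<partial>M) = B"
      unfolding B_def by (intro integral_cong_AE) auto
    with 1 show ?thesis by simp
  next
    case 2
    then have "AE x in M. g x = 0"
      using integral_nonneg_eq_0_iff_AE[OF g] by (auto simp: B_def)
    then have "(\<integral>x. \<bar>f x + g x\<bar> powr p \<partial>M) = A"
      unfolding A_def by (intro integral_cong_AE) auto
    with 2 show ?thesis by simp
  next
    case 3
    define a where "a = A powr (1 / p)"
    define b where "b = B powr (1 / p)"
    have ab: "a > 0" "b > 0" and ap: "a powr p = A" and bp: "b powr p = B"
      using 3 p by (auto simp: a_def b_def powr_powr)
    have "(\<integral>x. \<bar>f x + g x\<bar> powr p \<partial>M) \<le> (\<integral>x. (a + b) powr p *
        (a / (a + b) * (\<bar>f x\<bar> powr p / a powr p) + b / (a + b) * (\<bar>g x\<bar> powr p / b powr p)) \<partial>M)"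
    proof (rule integral_mono)
      show "integrable M (\<lambda>x. \<bar>f x + g x\<bar> powr p)"
        by (rule integrable_powr_abs_add) (use p f g in auto)
      show "integrable M (\<lambda>x. (a + b) powr p *
        (a / (a + b) * (\<bar>f x\<bar> powr p / a powr p) + b / (a + b) * (\<bar>g x\<bar> powr p / b powr p)))"
        using f g by (intro integrable_mult_right Bochner_Integration.integrable_add
            integrable_divide) auto
      show "\<bar>f x + g x\<bar> powr p \<le> (a + b) powr p *
        (a / (a + b) * (\<bar>f x\<bar> powr p / a powr p) + b / (a + b) * (\<bar>g x\<bar> powr p / b powr p))" for x
        by (rule powr_abs_add_bound[OF p ab])
    qed
    also have "\<dots> = (a + b) powr p * (a / (a + b) * (A / a powr p) + b / (a + b) * (B / b powr p))"
      unfolding A_def B_def using f g by simp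
    also have "\<dots> = (a + b) powr p"
      using ab 3 unfolding ap bp by (simp flip: add_divide_distrib)
    finally have "(\<integral>x. \<bar>f x + g x\<bar> powr p \<partial>M) powr (1 / p) \<le> ((a + b) powr p) powr (1 / p)"
      using p by (intro powr_mono2) auto
    also have "\<dots> = a + b" using p ab by (simp add: powr_powr)
    finally show ?thesis by (simp add: a_def b_def)
  qed
  then show ?thesis by (simp add: A_def B_def)
qed


section \<open>The sequence space of exponent \<open>p\<close>\<close>

definition lp_space :: "real \<Rightarrow> (nat \<Rightarrow> real) set" where
  "lp_space p = {x. summable (\<lambda>n. \<bar>x n\<bar> powr p)}"

definition lp_norm :: "real \<Rightarrow> (nat \<Rightarrow> real) \<Rightarrow> real" where
  "lp_norm p x = (\<Sum>n. \<bar>x n\<bar> powr p) powr (1 / p)"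

definition lp_metric :: "real \<Rightarrow> (nat \<Rightarrow> real) metric" where
  "lp_metric p = metric (lp_space p, \<lambda>x y. lp_norm p (x - y))"

lemma lp_space_integrable:
  "x \<in> lp_space p \<longleftrightarrow> integrable (count_space UNIV) (\<lambda>n. \<bar>x n\<bar> powr p)"
  by (simp add: lp_space_def integrable_count_space_nat_iff)

lemma lp_norm_integral:
  "x \<in> lp_space p \<Longrightarrow> lp_norm p x = (\<integral>n. \<bar>x n\<bar> powr p \<partial>count_space UNIV) powr (1 / p)"
  by (simp add: lp_norm_def lp_space_integrable integral_count_space_nat)

lemma lp_space_add:
  assumes "p \<ge> 1" "x \<in> lp_space p" "y \<in> lp_space p"
  shows "(\<lambda>n. x n + y n) \<in> lp_space p"
  using integrable_powr_abs_add[of p x "count_space UNIV" y] assms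
  by (simp add: lp_space_integrable)

lemma lp_norm_triangle:
  assumes "p \<ge> 1" "x \<in> lp_space p" "y \<in> lp_space p"
  shows "lp_norm p (\<lambda>n. x n + y n) \<le> lp_norm p x + lp_norm p y"
  using Minkowski_integral[of p x "count_space UNIV" y] assms lp_space_add[OF assms]
  by (simp add: lp_norm_integral lp_space_integrable)

lemma lp_space_diff:
  assumes "p \<ge> 1" "x \<in> lp_space p" "y \<in> lp_space p"
  shows "x - y \<in> lp_space p"
proof -
  have "(\<lambda>n. - y n) \<in> lp_space p" using assms by (simp add: lp_space_def)
  from lp_space_add[OF assms(1,2) this] show ?thesis by (simp add: fun_diff_def)
qed

lemma lp_norm_eq_0:
  assumes "x \<in> lp_space p"
  shows "lp_norm p x = 0 \<longleftrightarrow> x = (\<lambda>_. 0)"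
  using assms suminf_eq_zero_iff[of "\<lambda>n. \<bar>x n\<bar> powr p"]
  by (auto simp: lp_norm_def lp_space_def)

lemma Metric_space_lp:
  assumes p: "p \<ge> 1"
  shows "Metric_space (lp_space p) (\<lambda>x y. lp_norm p (x - y))"
proof
  fix x y z
  show "0 \<le> lp_norm p (x - y)" by (simp add: lp_norm_def)
  show "lp_norm p (x - y) = lp_norm p (y - x)"
    by (simp add: lp_norm_def abs_minus_commute)
  assume x: "x \<in> lp_space p" and y: "y \<in> lp_space p"
  show "(lp_norm p (x - y) = 0) = (x = y)"
    using lp_norm_eq_0[OF lp_space_diff[OF p x y]] by (auto simp: fun_eq_iff)
  assume z: "z \<in> lp_space p"
  show "lp_norm p (x - z) \<le> lp_norm p (x - y) + lp_norm p (y - z)"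
    using lp_norm_triangle[OF p lp_space_diff[OF p x y] lp_space_diff[OF p y z]]
    by (simp add: fun_diff_def)
qed

lemma mspace_lp_metric [simp]: "p \<ge> 1 \<Longrightarrow> mspace (lp_metric p) = lp_space p"
  unfolding lp_metric_def by (rule Metric_space.mspace_metric[OF Metric_space_lp])

lemma mdist_lp_metric [simp]: "p \<ge> 1 \<Longrightarrow> mdist (lp_metric p) x y = lp_norm p (x - y)"
  unfolding lp_metric_def by (simp add: Metric_space.mdist_metric[OF Metric_space_lp])


section \<open>The Lebesgue space of exponent \<open>p\<close> on the unit interval\<close>

abbreviation I01 :: "real measure" where
  "I01 \<equiv> lebesgue_on {0..1}"

text \<open>Classes of measurable functions on the unit interval modulo equality almost everywhere.
  Representatives are total functions on the reals; their values off the interval are irrelevant.\<close>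

quotient_type ae_fun = "real \<Rightarrow> real" / partial:
  "\<lambda>f g. f \<in> borel_measurable I01 \<and> g \<in> borel_measurable I01 \<and> (AE x in I01. f x = g x)"
proof (rule part_equivpI)
  show "\<exists>f :: real \<Rightarrow> real. f \<in> borel_measurable I01 \<and> f \<in> borel_measurable I01 \<and> (AE x in I01. f x = f x)"
    by (rule exI[of _ "\<lambda>_. 0"]) simp
qed (auto intro!: sympI transpI elim: AE_mp)

instantiation ae_fun :: real_vector
begin

lift_definition zero_ae_fun :: ae_fun is "\<lambda>_. 0" by simp

lift_definition plus_ae_fun :: "ae_fun \<Rightarrow> ae_fun \<Rightarrow> ae_fun" is "\<lambda>f g x. f x + g x" by auto

lift_definition minus_ae_fun :: "ae_fun \<Rightarrow> ae_fun \<Rightarrow> ae_fun" is "\<lambda>f g x. f x - g x" by auto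

lift_definition uminus_ae_fun :: "ae_fun \<Rightarrow> ae_fun" is "\<lambda>f x. - f x" by auto

lift_definition scaleR_ae_fun :: "real \<Rightarrow> ae_fun \<Rightarrow> ae_fun" is "\<lambda>c f x. c * f x" by auto

instance
  by standard (transfer; auto simp: algebra_simps)+

end

lift_definition in_Lp :: "real \<Rightarrow> ae_fun \<Rightarrow> bool" is
  "\<lambda>p f. integrable I01 (\<lambda>x. \<bar>f x\<bar> powr p)"
proof (elim conjE)
  fix p and f g :: "real \<Rightarrow> real"
  assume [measurable]: "f \<in> borel_measurable I01" "g \<in> borel_measurable I01"
    and "AE x in I01. f x = g x"
  then show "integrable I01 (\<lambda>x. \<bar>f x\<bar> powr p) = integrable I01 (\<lambda>x. \<bar>g x\<bar> powr p)"
    by (intro integrable_cong_AE) auto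
qed

definition Lp_space :: "real \<Rightarrow> ae_fun set" where
  "Lp_space p = {F. in_Lp p F}"

lift_definition Lp_norm :: "real \<Rightarrow> ae_fun \<Rightarrow> real" is
  "\<lambda>p f. (\<integral>x. \<bar>f x\<bar> powr p \<partial>I01) powr (1 / p)"
proof (elim conjE)
  fix p and f g :: "real \<Rightarrow> real"
  assume [measurable]: "f \<in> borel_measurable I01" "g \<in> borel_measurable I01"
    and "AE x in I01. f x = g x"
  then have "(\<integral>x. \<bar>f x\<bar> powr p \<partial>I01) = (\<integral>x. \<bar>g x\<bar> powr p \<partial>I01)"
    by (intro integral_cong_AE) auto
  then show "(\<integral>x. \<bar>f x\<bar> powr p \<partial>I01) powr (1 / p) = (\<integral>x. \<bar>g x\<bar> powr p \<partial>I01) powr (1 / p)"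
    by simp
qed

definition Lp_metric :: "real \<Rightarrow> ae_fun metric" where
  "Lp_metric p = metric (Lp_space p, \<lambda>F G. Lp_norm p (F - G))"

lemma Lp_space_add:
  assumes "p \<ge> 1" "F \<in> Lp_space p" "G \<in> Lp_space p"
  shows "F + G \<in> Lp_space p"
  using assms unfolding Lp_space_def mem_Collect_eq
  by transfer (auto intro: integrable_powr_abs_add)

lemma Lp_norm_triangle:
  assumes "p \<ge> 1" "F \<in> Lp_space p" "G \<in> Lp_space p"
  shows "Lp_norm p (F + G) \<le> Lp_norm p F + Lp_norm p G"
  using assms unfolding Lp_space_def mem_Collect_eq
  by transfer (auto intro: Minkowski_integral)

lemma Lp_space_uminus: "F \<in> Lp_space p \<Longrightarrow> - F \<in> Lp_space p"
  unfolding Lp_space_def mem_Collect_eq by transfer simp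

lemma Lp_space_diff:
  assumes "p \<ge> 1" "F \<in> Lp_space p" "G \<in> Lp_space p"
  shows "F - G \<in> Lp_space p"
  using Lp_space_add[OF assms(1,2) Lp_space_uminus[OF assms(3)]] by simp

lemma Lp_norm_uminus: "Lp_norm p (- F) = Lp_norm p F"
  by transfer simp

lemma Lp_norm_nonneg: "0 \<le> Lp_norm p F"
  by transfer simp

lemma Lp_norm_eq_0:
  assumes "F \<in> Lp_space p"
  shows "Lp_norm p F = 0 \<longleftrightarrow> F = 0"
  using assms unfolding Lp_space_def mem_Collect_eq
proof transfer
  fix F :: "real \<Rightarrow> real" and p :: real
  assume F: "F \<in> borel_measurable I01 \<and> F \<in> borel_measurable I01 \<and> (AE x in I01. F x = F x)"
    and int: "integrable I01 (\<lambda>x. \<bar>F x\<bar> powr p)"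
  have "(\<integral>x. \<bar>F x\<bar> powr p \<partial>I01) = 0 \<longleftrightarrow> (AE x in I01. F x = 0)"
    using integral_nonneg_eq_0_iff_AE[OF int] by simp
  then show "((\<integral>x. \<bar>F x\<bar> powr p \<partial>I01) powr (1 / p) = 0) \<longleftrightarrow>
      F \<in> borel_measurable I01 \<and> (\<lambda>_. 0) \<in> borel_measurable I01 \<and> (AE x in I01. F x = 0)"
    using F by simp
qed

lemma Metric_space_Lp:
  assumes p: "p \<ge> 1"
  shows "Metric_space (Lp_space p) (\<lambda>F G. Lp_norm p (F - G))"
proof
  fix F G H
  show "0 \<le> Lp_norm p (F - G)" by (rule Lp_norm_nonneg)
  show "Lp_norm p (F - G) = Lp_norm p (G - F)"
    using Lp_norm_uminus[of p "F - G"] by simp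
  assume F: "F \<in> Lp_space p" and G: "G \<in> Lp_space p"
  show "(Lp_norm p (F - G) = 0) = (F = G)"
    using Lp_norm_eq_0[OF Lp_space_diff[OF p F G]] by simp
  assume H: "H \<in> Lp_space p"
  show "Lp_norm p (F - H) \<le> Lp_norm p (F - G) + Lp_norm p (G - H)"
    using Lp_norm_triangle[OF p Lp_space_diff[OF p F G] Lp_space_diff[OF p G H]] by simp
qed

lemma mspace_Lp_metric [simp]: "p \<ge> 1 \<Longrightarrow> mspace (Lp_metric p) = Lp_space p"
  unfolding Lp_metric_def by (rule Metric_space.mspace_metric[OF Metric_space_Lp])

lemma mdist_Lp_metric [simp]: "p \<ge> 1 \<Longrightarrow> mdist (Lp_metric p) F G = Lp_norm p (F - G)"
  unfolding Lp_metric_def by (simp add: Metric_space.mdist_metric[OF Metric_space_Lp])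

end

theory Submission
  imports Defs
begin

text \<open>
  Put \<open>r = max 2 p\<close>, so that \<open>r < q\<close>, and suppose that the images of any two points at distance \<open>t\<close>
  are at least \<open>e > 0\<close> apart.  Place the lattice \<open>(t / 2K) \<int>\<^sup>n\<close> inside the domain, through an isometric
  copy of the \<open>n\<close>-dimensional space with the \<open>q\<close>-norm.  A move by \<open>2K\<close> lattice steps along one coordinate
  axis (a long edge) has length exactly \<open>t\<close>, whereas a move by a vector with all coordinates in
  \<open>{-1, 0, 1}\<close> (a short edge) has length at most \<open>n powr (1/q) * t / 2K\<close>.

  The spaces in the range satisfy a metric cotype inequality with exponent \<open>r\<close>, in the sense of Mendel
  and Naor: up to a constant, the mean of the \<open>p\<close>-th power of the displacement of the image over all long
  edges is at most \<open>1 + (2K) powr r / n\<close> times the supremum over the short edges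
  (\<open>metric_cotype_Lp\<close>).  With \<open>n\<close> close to \<open>K powr r\<close> this factor stays bounded, while the length of the
  short edges is of order \<open>K powr (r / q - 1)\<close>, which tends to \<open>0\<close>.  Uniform continuity then makes the
  displacement over short edges as small as desired, hence also over some long edge: a contradiction
  (\<open>equidistant_pair_with_close_images\<close>).

  The cotype inequality is linear in the \<open>p\<close>-th powers of the distances, and these are integrals of
  \<open>p\<close>-th powers of differences of real numbers.  It therefore suffices to prove it for real-valued
  functions \<open>g\<close> on the lattice.

  For exponents \<open>r \<ge> 2\<close> (\<open>scalar_cotype_ge2\<close>) let \<open>A\<^sub>j g x\<close> be the mean of \<open>g\<close> over the points
  \<open>x + \<epsilon>\<close>, where \<open>\<epsilon>\<close> has random signs in all coordinates except the \<open>j\<close>-th, which is \<open>0\<close>.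
  Replacing \<open>g\<close> by \<open>A\<^sub>j g\<close> costs only short edges.  The increment of \<open>A\<^sub>j g\<close> over two lattice steps in
  direction \<open>j\<close> is twice the \<open>j\<close>-th Rademacher coefficient of \<open>\<epsilon> \<mapsto> g (x + \<epsilon>)\<close>, and Bessel's inequality
  bounds all \<open>n\<close> coefficients together by the displacement of \<open>g\<close> over short edges.

  For \<open>p < 2\<close> (\<open>scalar_cotype_less2\<close>) the inequality follows from its case \<open>r = 2\<close>, applied to
  \<open>cos (u g)\<close> and \<open>sin (u g)\<close> for all \<open>u > 0\<close>:  since
  \<open>\<bar>exp (i u a) - exp (i u b)\<bar>\<^sup>2 = 2 (1 - cos (u (a - b)))\<close>, integration against \<open>u powr (-p-1) du\<close> turns
  the squared distances into a constant multiple of \<open>\<bar>a - b\<bar> powr p\<close>.  This is the classical embedding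
  of a power of the metric of the line into Hilbert space.
\<close>


section \<open>Power means\<close>


lemma abs_sum_powr_le:
  fixes a :: "'i \<Rightarrow> real"
  assumes "finite A" and r: "r \<ge> 1"
  shows "\<bar>\<Sum>i\<in>A. a i\<bar> powr r \<le> real (card A) powr (r - 1) * (\<Sum>i\<in>A. \<bar>a i\<bar> powr r)"
proof (cases "A = {}")
  case False
  define N where "N = real (card A)"
  have N: "N > 0"
    using False assms by (simp add: N_def card_gt_0_iff)
  have conv: "convex_on {0..} (\<lambda>x::real. x powr r)"
  proof (rule convex_onI)
    fix t x y :: real
    assume "0 < t" "t < 1" "x \<in> {0..}" "y \<in> {0..}"
    then show "((1 - t) *\<^sub>R x + t *\<^sub>R y) powr r \<le> (1 - t) * x powr r + t * y powr r"
      using powr_convex_nonneg[OF r, of "1 - t" t x y] by simp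
  qed simp
  have "\<bar>\<Sum>i\<in>A. a i\<bar> powr r \<le> (N * (\<Sum>i\<in>A. (1 / N) *\<^sub>R \<bar>a i\<bar>)) powr r"
    using N r by (intro powr_mono2) (auto simp flip: sum_divide_distrib)
  also have "\<dots> = N powr r * (\<Sum>i\<in>A. (1 / N) *\<^sub>R \<bar>a i\<bar>) powr r"
    using N by (simp add: powr_mult sum_nonneg)
  also have "\<dots> \<le> N powr r * (\<Sum>i\<in>A. (1 / N) * \<bar>a i\<bar> powr r)"
    using N False assms
    by (intro mult_left_mono convex_on_sum[OF _ _ conv]) (auto simp: N_def)
  also have "\<dots> = N powr (r - 1) * (\<Sum>i\<in>A. \<bar>a i\<bar> powr r)"
    using N by (simp add: powr_diff flip: sum_distrib_left sum_divide_distrib)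
  finally show ?thesis by (simp add: N_def)
qed simp

corollary abs_mean_powr_le:
  fixes a :: "'i \<Rightarrow> real"
  assumes "finite A" and r: "r \<ge> 1"
  shows "\<bar>(\<Sum>i\<in>A. a i) / card A\<bar> powr r \<le> (\<Sum>i\<in>A. \<bar>a i\<bar> powr r) / card A"
proof (cases "A = {}")
  case False
  then have N: "real (card A) > 0"
    using assms by (simp add: card_gt_0_iff)
  have "\<bar>(\<Sum>i\<in>A. a i) / card A\<bar> powr r = \<bar>\<Sum>i\<in>A. a i\<bar> powr r / card A powr r"
    by (simp add: powr_divide abs_divide)
  also have "\<dots> \<le> real (card A) powr (r - 1) * (\<Sum>i\<in>A. \<bar>a i\<bar> powr r) / card A powr r"
    by (intro divide_right_mono abs_sum_powr_le assms) auto
  also have "\<dots> = (\<Sum>i\<in>A. \<bar>a i\<bar> powr r) / card A"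
    using N by (simp add: powr_diff)
  finally show ?thesis .
qed simp

lemma abs_add3_powr_le:
  fixes a b c :: real
  assumes "r \<ge> 1"
  shows "\<bar>a + b + c\<bar> powr r \<le> 3 powr (r - 1) * (\<bar>a\<bar> powr r + \<bar>b\<bar> powr r + \<bar>c\<bar> powr r)"
  using abs_sum_powr_le[of "{..<3::nat}" r "\<lambda>i. [a, b, c] ! i"] assms
  by (simp add: eval_nat_numeral)

lemma power2_powr_half: "(x\<^sup>2) powr (r / 2) = \<bar>x\<bar> powr r" for x r :: real
proof -
  have "(x\<^sup>2) powr (r / 2) = (\<bar>x\<bar> powr 2) powr (r / 2)"
    by (cases "x = 0") (simp_all add: powr_numeral)
  then show ?thesis by (simp only: powr_powr) simp
qed

text \<open>The \<open>\<ell>\<^sub>r\<close> norm is at most the \<open>\<ell>\<^sub>2\<close> norm: each square is at most the whole sum of squares, so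
  \<open>\<bar>c j\<bar> powr r\<close> exceeds \<open>(c j)\<^sup>2\<close> by at most the factor \<open>T powr (r/2 - 1)\<close>, where \<open>T\<close> is that sum.\<close>
lemma sum_powr_le_powr_sum_squares:
  fixes c :: "'i \<Rightarrow> real"
  assumes "finite A" "r \<ge> 2"
  shows "(\<Sum>j\<in>A. \<bar>c j\<bar> powr r) \<le> (\<Sum>j\<in>A. (c j)\<^sup>2) powr (r / 2)"
proof -
  define T where "T = (\<Sum>j\<in>A. (c j)\<^sup>2)"
  have "\<bar>c j\<bar> powr r \<le> (c j)\<^sup>2 * T powr (r / 2 - 1)" if "j \<in> A" for j
  proof (cases "c j = 0")
    case False
    have le: "(c j)\<^sup>2 \<le> T"
      unfolding T_def by (rule member_le_sum) (use that assms in auto)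
    have "\<bar>c j\<bar> powr r = ((c j)\<^sup>2) powr (1 + (r / 2 - 1))"
      by (simp add: power2_powr_half)
    also have "\<dots> = (c j)\<^sup>2 * ((c j)\<^sup>2) powr (r / 2 - 1)"
      using False by (subst powr_add) simp
    also have "\<dots> \<le> (c j)\<^sup>2 * T powr (r / 2 - 1)"
      using le assms by (intro mult_left_mono powr_mono2) auto
    finally show ?thesis .
  qed simp
  then have "(\<Sum>j\<in>A. \<bar>c j\<bar> powr r) \<le> T * T powr (r / 2 - 1)"
    unfolding T_def sum_distrib_right by (intro sum_mono) auto
  also have "\<dots> = T powr (r / 2)"
    by (cases "T = 0") (auto simp: T_def powr_diff sum_nonneg)
  finally show ?thesis by (simp add: T_def)
qed

section \<open>Rademacher coefficients\<close>

text \<open>Sign vectors of length \<open>n\<close> are indexed by the set \<open>S\<close> of their positive coordinates; summing over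
  \<open>S \<in> Pow {..<n}\<close> and dividing by \<open>2 ^ n\<close> is the expectation over independent random signs.  Beyond
  the first \<open>n\<close> coordinates the vector vanishes.\<close>
definition sign_vector :: "nat \<Rightarrow> nat set \<Rightarrow> nat \<Rightarrow> int" where
  "sign_vector n S i = (if i \<in> S then 1 else if i < n then -1 else 0)"

definition toggle :: "'i \<Rightarrow> 'i set \<Rightarrow> 'i set" where
  "toggle j S = (if j \<in> S then S - {j} else insert j S)"

lemma sum_toggle:
  assumes "j < n"
  shows "(\<Sum>S\<in>Pow {..<n}. h (toggle j S)) = (\<Sum>S\<in>Pow {..<n}. h S)"
  by (rule sum.reindex_bij_witness[of _ "toggle j" "toggle j"])
     (use assms in \<open>auto simp: toggle_def split: if_splits\<close>)

text \<open>Flipping the \<open>j\<close>-th sign permutes the sign vectors, so anything odd under this flip has mean zero.\<close>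
lemma sum_toggle_odd_eq_0:
  fixes h :: "nat set \<Rightarrow> real"
  assumes "j < n" and "\<And>S. h (toggle j S) = - h S"
  shows "(\<Sum>S\<in>Pow {..<n}. h S) = 0"
  using sum_toggle[OF assms(1), of h] by (simp add: assms(2) sum_negf)

lemma sign_vector_toggle:
  assumes "j < n"
  shows "sign_vector n (toggle j S) = (sign_vector n S)(j := - sign_vector n S j)"
  using assms by (auto simp: sign_vector_def toggle_def fun_eq_iff)

lemma sum_sign: "j < n \<Longrightarrow> (\<Sum>S\<in>Pow {..<n}. real_of_int (sign_vector n S j)) = 0"
  by (rule sum_toggle_odd_eq_0[of j]) (auto simp: sign_vector_toggle)

lemma sum_sign_mult:
  assumes "j < n" "k < n"
  shows "(\<Sum>S\<in>Pow {..<n}. real_of_int (sign_vector n S j) * real_of_int (sign_vector n S k)) =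
         (if j = k then 2 ^ n else 0)"
proof (cases "j = k")
  case True
  have "(\<Sum>S\<in>Pow {..<n}. real_of_int (sign_vector n S j) * real_of_int (sign_vector n S k)) =
        (\<Sum>S\<in>Pow {..<n}. 1)"
    by (rule sum.cong) (use True assms in \<open>auto simp: sign_vector_def\<close>)
  then show ?thesis using True by (simp add: card_Pow)
next
  case False
  then show ?thesis using assms
    by (simp, intro sum_toggle_odd_eq_0[of j]) (auto simp: sign_vector_toggle)
qed

text \<open>The coordinate functions are orthonormal for the normalised counting measure; expand the square of
  the distance from \<open>G\<close> to its orthogonal projection onto their span.\<close>
lemma Bessel_signs:
  fixes G :: "nat set \<Rightarrow> real"
  shows "(\<Sum>j<n. ((\<Sum>S\<in>Pow {..<n}. sign_vector n S j * G S) / 2 ^ n)\<^sup>2)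
         \<le> (\<Sum>S\<in>Pow {..<n}. (G S)\<^sup>2) / 2 ^ n"
proof -
  define c where "c j = (\<Sum>S\<in>Pow {..<n}. sign_vector n S j * G S) / 2 ^ n" for j
  define P where "P S = (\<Sum>j<n. c j * sign_vector n S j)" for S
  have GP: "(\<Sum>S\<in>Pow {..<n}. G S * P S) = 2 ^ n * (\<Sum>j<n. (c j)\<^sup>2)"
  proof -
    have sums: "(\<Sum>S\<in>Pow {..<n}. sign_vector n S j * G S) = 2 ^ n * c j" for j
      by (simp add: c_def)
    have "(\<Sum>S\<in>Pow {..<n}. G S * P S) = (\<Sum>j<n. \<Sum>S\<in>Pow {..<n}. c j * (sign_vector n S j * G S))"
      unfolding P_def sum_distrib_left by (subst sum.swap) (simp add: mult_ac)
    also have "\<dots> = (\<Sum>j<n. c j * (2 ^ n * c j))"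
      by (simp only: sums flip: sum_distrib_left)
    finally show ?thesis
      by (simp add: sum_distrib_left power2_eq_square mult_ac)
  qed
  have PP: "(\<Sum>S\<in>Pow {..<n}. (P S)\<^sup>2) = 2 ^ n * (\<Sum>j<n. (c j)\<^sup>2)"
  proof -
    have "(\<Sum>S\<in>Pow {..<n}. (P S)\<^sup>2) =
      (\<Sum>S\<in>Pow {..<n}. \<Sum>j<n. \<Sum>k<n. c j * c k * (real_of_int (sign_vector n S j) * sign_vector n S k))"
      by (simp add: P_def power2_eq_square sum_product mult_ac)
    also have "\<dots> = (\<Sum>j<n. \<Sum>k<n. \<Sum>S\<in>Pow {..<n}.
        c j * c k * (real_of_int (sign_vector n S j) * sign_vector n S k))"
      by (subst sum.swap, rule sum.cong[OF refl], subst sum.swap) (rule refl)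
    also have "\<dots> = (\<Sum>j<n. \<Sum>k<n. c j * c k * (if j = k then 2 ^ n else 0))"
      by (intro sum.cong refl) (simp add: sum_sign_mult flip: sum_distrib_left)
    also have "\<dots> = (\<Sum>j<n. c j * c j * 2 ^ n)"
      by (rule sum.cong) (auto simp: if_distrib sum.delta' cong: if_cong)
    finally show ?thesis
      by (simp add: sum_distrib_left power2_eq_square mult_ac)
  qed
  have "0 \<le> (\<Sum>S\<in>Pow {..<n}. (G S - P S)\<^sup>2)"
    by (intro sum_nonneg) auto
  also have "\<dots> = (\<Sum>S\<in>Pow {..<n}. (G S)\<^sup>2) - 2 * (\<Sum>S\<in>Pow {..<n}. G S * P S)
                    + (\<Sum>S\<in>Pow {..<n}. (P S)\<^sup>2)"
    by (simp add: power2_diff sum.distrib sum_subtractf sum_distrib_left mult_ac)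
  finally have "2 ^ n * (\<Sum>j<n. (c j)\<^sup>2) \<le> (\<Sum>S\<in>Pow {..<n}. (G S)\<^sup>2)"
    unfolding GP PP by simp
  then show ?thesis
    by (simp add: c_def pos_le_divide_eq mult.commute)
qed

text \<open>For \<open>r \<ge> 2\<close> the real line has cotype \<open>r\<close> with constant 1: compare the \<open>\<ell>\<^sub>r\<close> norm of the coefficients
  with the \<open>\<ell>\<^sub>2\<close> norm, apply Bessel's inequality, and then compare the quadratic mean of \<open>G\<close> with its mean
  of order \<open>r\<close>.\<close>
lemma sum_powr_sign_coefficients_le:
  fixes G :: "nat set \<Rightarrow> real"
  assumes r: "r \<ge> 2"
  shows "(\<Sum>j<n. \<bar>(\<Sum>S\<in>Pow {..<n}. sign_vector n S j * G S) / 2 ^ n\<bar> powr r)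
         \<le> (\<Sum>S\<in>Pow {..<n}. \<bar>G S\<bar> powr r) / 2 ^ n"
proof -
  have "(\<Sum>j<n. \<bar>(\<Sum>S\<in>Pow {..<n}. sign_vector n S j * G S) / 2 ^ n\<bar> powr r)
      \<le> (\<Sum>j<n. ((\<Sum>S\<in>Pow {..<n}. sign_vector n S j * G S) / 2 ^ n)\<^sup>2) powr (r / 2)"
    using r by (intro sum_powr_le_powr_sum_squares) auto
  also have "\<dots> \<le> \<bar>(\<Sum>S\<in>Pow {..<n}. (G S)\<^sup>2) / 2 ^ n\<bar> powr (r / 2)"
    using r order_trans[OF Bessel_signs abs_ge_self, of n G]
    by (intro powr_mono2) (auto intro: sum_nonneg)
  also have "\<dots> \<le> (\<Sum>S\<in>Pow {..<n}. \<bar>(G S)\<^sup>2\<bar> powr (r / 2)) / 2 ^ n"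
    using abs_mean_powr_le[of "Pow {..<n}" "r / 2" "\<lambda>S. (G S)\<^sup>2"] r by (simp add: card_Pow)
  finally show ?thesis by (simp add: power2_powr_half)
qed


section \<open>Long and short edges of the lattice\<close>

definition shift :: "(nat \<Rightarrow> int) \<Rightarrow> (nat \<Rightarrow> int) \<Rightarrow> nat \<Rightarrow> int" where
  "shift x v i = x i + v i"

definition jump :: "nat \<Rightarrow> int \<Rightarrow> (nat \<Rightarrow> int) \<Rightarrow> nat \<Rightarrow> int" where
  "jump j a x = x(j := x j + a)"

definition box :: "nat \<Rightarrow> nat \<Rightarrow> (nat \<Rightarrow> int) set" where
  "box n L = PiE {..<n} (\<lambda>_. {0..<int L})"

lemma finite_box [simp]: "finite (box n L)"
  by (simp add: box_def finite_PiE)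

lemma card_box: "card (box n L) = L ^ n"
  by (simp add: box_def card_PiE)

text \<open>A finite box replaces the torus on which metric cotype is usually stated.  A box is not translation
  invariant, but a translate of it lies in a slightly larger box, which is enough to bound sums of
  nonnegative terms.\<close>
lemma sum_box_jump_le:
  fixes h :: "(nat \<Rightarrow> int) \<Rightarrow> real"
  assumes "j < n" and a: "0 \<le> a" "a \<le> int M" and h: "\<And>x. 0 \<le> h x"
  shows "(\<Sum>x\<in>box n L. h (jump j a x)) \<le> (\<Sum>x\<in>box n (L + M). h x)"
proof -
  have "inj (jump j a)"
  proof (rule injI)
    fix x y assume eq: "jump j a x = jump j a y"
    have "x i = y i" for i
      using fun_cong[OF eq, of i] by (simp add: jump_def split: if_splits)
    then show "x = y" by blast
  qed
  then have "(\<Sum>x\<in>box n L. h (jump j a x)) = sum h (jump j a ` box n L)"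
    by (subst sum.reindex) (auto intro: inj_on_subset)
  also have "\<dots> \<le> (\<Sum>x\<in>box n (L + M). h x)"
  proof (rule sum_mono2)
    show "jump j a ` box n L \<subseteq> box n (L + M)"
      using assms by (force simp: box_def jump_def PiE_iff extensional_def)
  qed (use h in auto)
  finally show ?thesis .
qed

definition punctured_sign :: "nat \<Rightarrow> nat \<Rightarrow> nat set \<Rightarrow> nat \<Rightarrow> int" where
  "punctured_sign n j S = (sign_vector n S)(j := 0)"

text \<open>The two sides of the cotype inequality, as functionals of an arbitrary \<open>\<Phi>\<close> that plays the role of a
  power of the distance between images.  Both are linear in \<open>\<Phi>\<close>, which later allows integrating the
  inequality.\<close>
definition long_edges ::
  "nat \<Rightarrow> nat \<Rightarrow> nat \<Rightarrow> ((nat \<Rightarrow> int) \<Rightarrow> (nat \<Rightarrow> int) \<Rightarrow> real) \<Rightarrow> real" where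
  "long_edges n K L \<Phi> = (\<Sum>j<n. \<Sum>x\<in>box n L. \<Phi> (jump j (2 * int K) x) x)"

text \<open>The first part collects the cost of replacing a function by its mean \<open>A\<^sub>j\<close> at both ends of a long edge;
  the second part is the bound for the increment of the means.  The latter lives on a larger box
  because the \<open>K\<close> double steps of a long edge leave the original one.\<close>
definition short_edges ::
  "real \<Rightarrow> nat \<Rightarrow> nat \<Rightarrow> nat \<Rightarrow> ((nat \<Rightarrow> int) \<Rightarrow> (nat \<Rightarrow> int) \<Rightarrow> real) \<Rightarrow> real" where
  "short_edges r n K L \<Phi> =
     (\<Sum>j<n. \<Sum>x\<in>box n L. \<Sum>S\<in>Pow {..<n}.
        (\<Phi> (shift (jump j (2 * int K) x) (punctured_sign n j S)) (jump j (2 * int K) x)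
         + \<Phi> (shift x (punctured_sign n j S)) x) / 2 ^ n)
     + (2 * real K) powr r *
       (\<Sum>x\<in>box n (L + 2 * K). \<Sum>S\<in>Pow {..<n}. \<Phi> (shift x (sign_vector n S)) x / 2 ^ n)"

section \<open>The cotype inequality for real functions and exponents at least two\<close>

text \<open>The operator \<open>A\<^sub>j\<close> of the introductory remarks, and the \<open>j\<close>-th Rademacher coefficient of
  \<open>\<epsilon> \<mapsto> g (x + \<epsilon>) - g x\<close>.\<close>
definition punctured_mean :: "nat \<Rightarrow> nat \<Rightarrow> ((nat \<Rightarrow> int) \<Rightarrow> real) \<Rightarrow> (nat \<Rightarrow> int) \<Rightarrow> real" where
  "punctured_mean n j g x = (\<Sum>S\<in>Pow {..<n}. g (shift x (punctured_sign n j S))) / 2 ^ n"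

definition sign_coefficient :: "nat \<Rightarrow> nat \<Rightarrow> ((nat \<Rightarrow> int) \<Rightarrow> real) \<Rightarrow> (nat \<Rightarrow> int) \<Rightarrow> real" where
  "sign_coefficient n j g x =
     (\<Sum>S\<in>Pow {..<n}. real_of_int (sign_vector n S j) * (g (shift x (sign_vector n S)) - g x)) / 2 ^ n"

lemma punctured_mean_close:
  assumes "r \<ge> 1"
  shows "\<bar>punctured_mean n j g x - g x\<bar> powr r
         \<le> (\<Sum>S\<in>Pow {..<n}. \<bar>g (shift x (punctured_sign n j S)) - g x\<bar> powr r / 2 ^ n)"
proof -
  have "punctured_mean n j g x - g x
      = (\<Sum>S\<in>Pow {..<n}. g (shift x (punctured_sign n j S)) - g x) / card (Pow {..<n})"
    by (simp add: punctured_mean_def sum_subtractf card_Pow diff_divide_distrib)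
  then show ?thesis
    using abs_mean_powr_le[OF _ assms, of "Pow {..<n}" "\<lambda>S. g (shift x (punctured_sign n j S)) - g x"]
    by (simp add: card_Pow sum_divide_distrib)
qed

text \<open>Split the sign vectors according to the \<open>j\<close>-th sign: moving by \<open>\<plusminus>1\<close> in direction \<open>j\<close> fills in the
  coordinate that the mean leaves out, so the difference of the two means is twice a Rademacher coefficient.
  Subtracting \<open>g x\<close> in that coefficient changes nothing, as the \<open>j\<close>-th sign has mean zero, but it
  expresses the coefficient through displacements over short edges.\<close>
lemma punctured_mean_derivative:
  assumes "j < n"
  shows "punctured_mean n j g (jump j 1 x) - punctured_mean n j g (jump j (-1) x)
         = 2 * sign_coefficient n j g x"
proof -
  define s where "s S = real_of_int (sign_vector n S j) * g (shift x (sign_vector n S))" for S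
  have "g (shift (jump j 1 x) (punctured_sign n j S)) - g (shift (jump j (-1) x) (punctured_sign n j S))
        = s S + s (toggle j S)" for S
  proof -
    have up: "shift (jump j 1 x) (punctured_sign n j S) = shift x ((sign_vector n S)(j := 1))"
     and down: "shift (jump j (-1) x) (punctured_sign n j S) = shift x ((sign_vector n S)(j := -1))"
      by (auto simp: shift_def jump_def punctured_sign_def fun_eq_iff)
    have self: "sign_vector n S = (sign_vector n S)(j := sign_vector n S j)" by simp
    consider "sign_vector n S j = 1" | "sign_vector n S j = -1"
      using assms unfolding sign_vector_def by (cases "j \<in> S") auto
    then show ?thesis
      unfolding up down s_def sign_vector_toggle[OF assms]
      by cases (metis (no_types, lifting) self add_uminus_conv_diff fun_upd_same minus_minus mult_1
          mult_minus1 of_int_1 of_int_minus add.commute)+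
  qed
  then have "punctured_mean n j g (jump j 1 x) - punctured_mean n j g (jump j (-1) x)
      = ((\<Sum>S\<in>Pow {..<n}. s S) + (\<Sum>S\<in>Pow {..<n}. s (toggle j S))) / 2 ^ n"
    unfolding punctured_mean_def
    by (simp flip: diff_divide_distrib sum_subtractf sum.distrib)
  also have "\<dots> = 2 * (\<Sum>S\<in>Pow {..<n}. s S) / 2 ^ n"
    using sum_toggle[OF assms, of s] by simp
  also have "(\<Sum>S\<in>Pow {..<n}. s S) = 2 ^ n * sign_coefficient n j g x"
    using sum_sign[OF assms]
    by (simp add: s_def sign_coefficient_def right_diff_distrib sum_subtractf flip: sum_distrib_right)
  finally show ?thesis by simp
qed

lemma punctured_mean_telescope:
  assumes "j < n"
  shows "punctured_mean n j g (jump j (2 * int K) x) - punctured_mean n j g x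
         = (\<Sum>i<K. 2 * sign_coefficient n j g (jump j (2 * int i + 1) x))"
proof -
  have step: "punctured_mean n j g (jump j (2 * int (Suc i)) x) - punctured_mean n j g (jump j (2 * int i) x)
      = 2 * sign_coefficient n j g (jump j (2 * int i + 1) x)" for i
  proof -
    have "jump j 1 (jump j (2 * int i + 1) x) = jump j (2 * int (Suc i)) x"
      and "jump j (-1) (jump j (2 * int i + 1) x) = jump j (2 * int i) x"
      by (auto simp: jump_def)
    then show ?thesis
      using punctured_mean_derivative[OF assms, of g "jump j (2 * int i + 1) x"] by simp
  qed
  have "jump j 0 x = x" by (simp add: jump_def)
  then show ?thesis
    using sum_lessThan_telescope[of "\<lambda>i. punctured_mean n j g (jump j (2 * int i) x)" K]
    by (simp only: step) simp
qed

text \<open>By Jensen's inequality the \<open>r\<close>-th power of a sum of \<open>K\<close> increments costs a factor \<open>K powr (r - 1)\<close>, and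
  each increment is, after translation, twice a Rademacher coefficient at a point of the larger box.
  For each such point the coefficients for all \<open>j\<close> are bounded at once; hence no factor \<open>n\<close>
  appears on the right, and this is what makes the inequality useful.\<close>
lemma punctured_mean_drift:
  assumes r: "r \<ge> 2"
  shows "(\<Sum>j<n. \<Sum>x\<in>box n L.
            \<bar>punctured_mean n j g (jump j (2 * int K) x) - punctured_mean n j g x\<bar> powr r)
         \<le> (2 * real K) powr r * (\<Sum>x\<in>box n (L + 2 * K). \<Sum>S\<in>Pow {..<n}.
              \<bar>g (shift x (sign_vector n S)) - g x\<bar> powr r / 2 ^ n)"
proof -
  define D where "D j y = \<bar>sign_coefficient n j g y\<bar> powr r" for j y
  have "(\<Sum>x\<in>box n L. \<bar>punctured_mean n j g (jump j (2 * int K) x) - punctured_mean n j g x\<bar> powr r)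
        \<le> (2 * real K) powr r * (\<Sum>y\<in>box n (L + 2 * K). D j y)" if j: "j < n" for j
  proof -
    have "(\<Sum>x\<in>box n L. \<bar>punctured_mean n j g (jump j (2 * int K) x) - punctured_mean n j g x\<bar> powr r)
        \<le> (\<Sum>x\<in>box n L. real K powr (r - 1) * (\<Sum>i<K. 2 powr r * D j (jump j (2 * int i + 1) x)))"
    proof (rule sum_mono)
      fix x
      show "\<bar>punctured_mean n j g (jump j (2 * int K) x) - punctured_mean n j g x\<bar> powr r
        \<le> real K powr (r - 1) * (\<Sum>i<K. 2 powr r * D j (jump j (2 * int i + 1) x))"
        using abs_sum_powr_le[of "{..<K}" r "\<lambda>i. 2 * sign_coefficient n j g (jump j (2 * int i + 1) x)"] r
        by (simp add: punctured_mean_telescope[OF j] D_def powr_mult abs_mult)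
    qed
    also have "\<dots> = real K powr (r - 1) * 2 powr r *
        (\<Sum>i<K. \<Sum>x\<in>box n L. D j (jump j (2 * int i + 1) x))"
      by (subst sum.swap) (simp add: sum_distrib_left mult_ac)
    also have "\<dots> \<le> real K powr (r - 1) * 2 powr r * (\<Sum>i<K. \<Sum>y\<in>box n (L + 2 * K). D j y)"
      by (intro mult_left_mono sum_mono sum_box_jump_le) (use j in \<open>auto simp: D_def\<close>)
    also have "\<dots> = (2 * real K) powr r * (\<Sum>y\<in>box n (L + 2 * K). D j y)"
      by (cases "K = 0") (auto simp: powr_mult powr_diff)
    finally show ?thesis .
  qed
  then have "(\<Sum>j<n. \<Sum>x\<in>box n L.
            \<bar>punctured_mean n j g (jump j (2 * int K) x) - punctured_mean n j g x\<bar> powr r)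
      \<le> (\<Sum>j<n. (2 * real K) powr r * (\<Sum>y\<in>box n (L + 2 * K). D j y))"
    by (intro sum_mono) auto
  also have "\<dots> = (2 * real K) powr r * (\<Sum>y\<in>box n (L + 2 * K). \<Sum>j<n. D j y)"
    by (subst sum.swap) (simp add: sum_distrib_left)
  also have "\<dots> \<le> (2 * real K) powr r * (\<Sum>y\<in>box n (L + 2 * K). \<Sum>S\<in>Pow {..<n}.
              \<bar>g (shift y (sign_vector n S)) - g y\<bar> powr r / 2 ^ n)"
    unfolding D_def sign_coefficient_def
    by (intro mult_left_mono sum_mono)
       (use sum_powr_sign_coefficients_le[OF r] in \<open>auto simp: sum_divide_distrib\<close>)
  finally show ?thesis .
qed

lemma scalar_cotype_ge2:
  assumes r: "r \<ge> 2"
  shows "long_edges n K L (\<lambda>x y. \<bar>g x - g y\<bar> powr r)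
         \<le> 3 powr (r - 1) * short_edges r n K L (\<lambda>x y. \<bar>g x - g y\<bar> powr r)"
proof -
  let ?m = "punctured_mean n"
  let ?j = "\<lambda>j. jump j (2 * int K)"
  have "long_edges n K L (\<lambda>x y. \<bar>g x - g y\<bar> powr r)
      \<le> (\<Sum>j<n. \<Sum>x\<in>box n L. 3 powr (r - 1) *
          (\<bar>?m j g (?j j x) - g (?j j x)\<bar> powr r + \<bar>?m j g (?j j x) - ?m j g x\<bar> powr r
           + \<bar>?m j g x - g x\<bar> powr r))"
    unfolding long_edges_def
  proof (intro sum_mono)
    fix j x
    show "\<bar>g (?j j x) - g x\<bar> powr r \<le> 3 powr (r - 1) *
        (\<bar>?m j g (?j j x) - g (?j j x)\<bar> powr r + \<bar>?m j g (?j j x) - ?m j g x\<bar> powr r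
           + \<bar>?m j g x - g x\<bar> powr r)"
      using abs_add3_powr_le[of r "g (?j j x) - ?m j g (?j j x)" "?m j g (?j j x) - ?m j g x" "?m j g x - g x"] r
      by (simp add: abs_minus_commute)
  qed
  also have "\<dots> = 3 powr (r - 1) * ((\<Sum>j<n. \<Sum>x\<in>box n L.
           \<bar>?m j g (?j j x) - g (?j j x)\<bar> powr r + \<bar>?m j g x - g x\<bar> powr r)
         + (\<Sum>j<n. \<Sum>x\<in>box n L. \<bar>?m j g (?j j x) - ?m j g x\<bar> powr r))"
    by (simp add: sum.distrib algebra_simps flip: sum_distrib_left)
  also have "\<dots> \<le> 3 powr (r - 1) * short_edges r n K L (\<lambda>x y. \<bar>g x - g y\<bar> powr r)"
    unfolding short_edges_def
  proof (intro mult_left_mono add_mono punctured_mean_drift r sum_mono)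
    fix j x
    show "\<bar>?m j g (?j j x) - g (?j j x)\<bar> powr r + \<bar>?m j g x - g x\<bar> powr r
      \<le> (\<Sum>S\<in>Pow {..<n}. (\<bar>g (shift (?j j x) (punctured_sign n j S)) - g (?j j x)\<bar> powr r
           + \<bar>g (shift x (punctured_sign n j S)) - g x\<bar> powr r) / 2 ^ n)"
      unfolding add_divide_distrib sum.distrib
      by (intro add_mono punctured_mean_close) (use r in auto)
  qed auto
  finally show ?thesis .
qed


section \<open>Integrating the inequality\<close>

lemma has_bochner_integral_long_edges:
  assumes "\<And>x y. has_bochner_integral M (\<lambda>u. \<Phi> u x y) (I x y)"
  shows "has_bochner_integral M (\<lambda>u. long_edges n K L (\<Phi> u)) (long_edges n K L I)"
  unfolding long_edges_def
  by (intro has_bochner_integral_sum assms)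

lemma has_bochner_integral_short_edges:
  assumes "\<And>x y. has_bochner_integral M (\<lambda>u. \<Phi> u x y) (I x y)"
  shows "has_bochner_integral M (\<lambda>u. short_edges r n K L (\<Phi> u)) (short_edges r n K L I)"
  unfolding short_edges_def
  by (intro has_bochner_integral_sum has_bochner_integral_add has_bochner_integral_mult_right
      has_bochner_integral_divide assms)

text \<open>The parameter \<open>u\<close> will be a frequency, to pass from squares to exponents below two, and then a point
  of the measure space carrying the target functions, to pass from real-valued maps to the map itself.\<close>
lemma edges_inequality_integral:
  assumes I: "\<And>x y. has_bochner_integral M (\<lambda>u. \<Phi> u x y) (I x y)"
    and le: "\<And>u. long_edges n K L (\<Phi> u) \<le> c * short_edges r n K L (\<Phi> u)"
  shows "long_edges n K L I \<le> c * short_edges r n K L I"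
proof -
  note long = has_bochner_integral_long_edges[OF I, of n K L]
  note short = has_bochner_integral_mult_right[OF has_bochner_integral_short_edges[OF I, of r n K L], of c]
  have "(\<integral>u. long_edges n K L (\<Phi> u) \<partial>M) \<le> (\<integral>u. c * short_edges r n K L (\<Phi> u) \<partial>M)"
    using long short le by (intro integral_mono) (auto simp: has_bochner_integral_iff)
  then show ?thesis
    by (simp only: has_bochner_integral_integral_eq[OF long] has_bochner_integral_integral_eq[OF short])
qed

lemma long_edges_add:
  "long_edges n K L (\<lambda>x y. \<Phi> x y + \<Psi> x y) = long_edges n K L \<Phi> + long_edges n K L \<Psi>"
  by (simp add: long_edges_def sum.distrib)

lemma short_edges_add:
  "short_edges r n K L (\<lambda>x y. \<Phi> x y + \<Psi> x y) = short_edges r n K L \<Phi> + short_edges r n K L \<Psi>"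
  by (simp add: short_edges_def sum.distrib add_divide_distrib algebra_simps)

lemma long_edges_scale: "long_edges n K L (\<lambda>x y. c * \<Phi> x y) = c * long_edges n K L \<Phi>"
  by (simp add: long_edges_def sum_distrib_left)

lemma short_edges_scale: "short_edges r n K L (\<lambda>x y. c * \<Phi> x y) = c * short_edges r n K L \<Phi>"
  by (simp add: short_edges_def sum_distrib_left algebra_simps add_divide_distrib)

section \<open>Exponents below two\<close>

definition cos_kernel :: "real \<Rightarrow> real \<Rightarrow> real" where
  "cos_kernel p u = indicator {0<..} u * ((1 - cos u) * u powr (- p - 1))"

lemma one_minus_cos_le: "1 - cos u \<le> u\<^sup>2 / 2" for u :: real
proof -
  have "1 - cos u = 2 * (sin (u / 2))\<^sup>2"
    using cos_double_sin[of "u / 2"] by simp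
  also have "\<dots> \<le> 2 * (u / 2)\<^sup>2"
    using abs_le_square_iff[of "sin (u / 2)" "u / 2"] abs_sin_x_le_abs_x[of "u / 2"] by simp
  finally show ?thesis by (simp add: power2_eq_square)
qed

lemma borel_measurable_cos_kernel [measurable]: "cos_kernel p \<in> borel_measurable borel"
  unfolding cos_kernel_def by measurable

lemma integrable_cos_kernel:
  assumes p: "0 < p" "p < 2"
  shows "integrable lborel (cos_kernel p)"
proof -
  have near0: "integrable lborel (\<lambda>u. indicator {0..1} u *\<^sub>R u powr (1 - p))"
  proof -
    have "(\<lambda>u::real. u powr (1 - p)) absolutely_integrable_on {0..1}"
      using p by (intro nonnegative_absolutely_integrable_1 integrable_on_powr_from_0) auto
    then show ?thesis
      unfolding set_integrable_def by (subst (asm) integrable_completion) auto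
  qed
  have near_inf: "integrable lborel (\<lambda>u. indicator {1..} u *\<^sub>R u powr (- p - 1))"
  proof -
    have "(\<lambda>u::real. u powr (- p - 1)) integrable_on {1..}"
      using has_integral_powr_to_inf[of "- p - 1" 1] p by auto
    then have "(\<lambda>u::real. u powr (- p - 1)) absolutely_integrable_on {1..}"
      by (intro nonnegative_absolutely_integrable_1) auto
    then show ?thesis
      unfolding set_integrable_def by (subst (asm) integrable_completion) auto
  qed
  show ?thesis
  proof (rule Bochner_Integration.integrable_bound)
    show "integrable lborel (\<lambda>u. indicator {0..1} u *\<^sub>R u powr (1 - p)
            + 2 * (indicator {1..} u *\<^sub>R u powr (- p - 1)))"
      by (intro Bochner_Integration.integrable_add integrable_mult_right near0 near_inf)
    have "cos_kernel p u \<le> indicator {0..1} u *\<^sub>R u powr (1 - p)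
            + 2 * (indicator {1..} u *\<^sub>R u powr (- p - 1))" for u
    proof -
      consider "u \<le> 0" | "0 < u" "u < 1" | "1 \<le> u" by linarith
      then show ?thesis
      proof cases
        case 1
        then show ?thesis by (simp add: cos_kernel_def)
      next
        case 2
        have "(1 - cos u) * u powr (- p - 1) \<le> u powr 2 * u powr (- p - 1)"
          using 2 order_trans[OF one_minus_cos_le, of u "u\<^sup>2"]
          by (intro mult_right_mono) (auto simp: powr_numeral)
        also have "\<dots> = u powr (1 - p)"
          by (simp flip: powr_add)
        finally show ?thesis using 2 by (simp add: cos_kernel_def)
      next
        case 3
        have "(1 - cos u) * u powr (- p - 1) \<le> 2 * u powr (- p - 1)"
          using cos_ge_minus_one[of u] by (intro mult_right_mono) auto
        then have "cos_kernel p u \<le> 2 * (indicator {1..} u *\<^sub>R u powr (- p - 1))"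
          using 3 by (simp add: cos_kernel_def)
        then show ?thesis
          by (rule order_trans) auto
      qed
    qed
    moreover have "0 \<le> cos_kernel p u" for u
      by (simp add: cos_kernel_def)
    ultimately show "AE u in lborel. norm (cos_kernel p u) \<le>
        norm (indicator {0..1} u *\<^sub>R u powr (1 - p) + 2 * (indicator {1..} u *\<^sub>R u powr (- p - 1)))"
      by (intro AE_I2) (metis abs_of_nonneg order_trans real_norm_def)
  qed measurable
qed

text \<open>On \<open>[1, 2]\<close> the kernel is bounded below by \<open>m > 0\<close>, since \<open>2 < \<pi>\<close> and the cosine decreases on \<open>[0, \<pi>]\<close>.\<close>
lemma integral_cos_kernel_pos:
  assumes p: "0 < p" "p < 2"
  shows "0 < integral\<^sup>L lborel (cos_kernel p)"
proof -
  define m where "m = (1 - cos 1) * 2 powr (- p - 1)"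
  have m: "m > 0"
    using cos_monotone_0_pi[of 0 1] pi_gt3 by (simp add: m_def)
  have "m = (\<integral>u. indicator {1..2::real} u * m \<partial>lborel)"
    by simp
  also have "\<dots> \<le> integral\<^sup>L lborel (cos_kernel p)"
  proof (rule integral_mono)
    show "indicator {1..2} u * m \<le> cos_kernel p u" for u
    proof (cases "u \<in> {1..2}")
      case True
      then have "cos u \<le> cos 1" "2 powr (- p - 1) \<le> u powr (- p - 1)"
        using cos_monotone_0_pi_le[of 1 u] pi_gt3 p powr_mono2'[of "p + 1" u 2]
        by (auto simp: powr_mono2')
      then have "m \<le> (1 - cos u) * u powr (- p - 1)"
        unfolding m_def by (intro mult_mono) auto
      then show ?thesis using True by (simp add: cos_kernel_def)
    qed (simp add: cos_kernel_def)
  qed (use integrable_cos_kernel[OF p] in \<open>auto intro!: integrable_mult_left\<close>)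
  finally show ?thesis using m by simp
qed

text \<open>Substitute \<open>u \<mapsto> \<bar>a\<bar> u\<close>: the weight \<open>u powr (-p-1) du\<close> is homogeneous of degree \<open>-p\<close>.\<close>
lemma has_bochner_integral_one_minus_cos:
  assumes p: "0 < p" "p < 2"
  shows "has_bochner_integral lborel (\<lambda>u. indicator {0<..} u * u powr (- p - 1) * (1 - cos (u * a)))
           (integral\<^sup>L lborel (cos_kernel p) * \<bar>a\<bar> powr p)"
proof (cases "a = 0")
  case False
  define b where "b = \<bar>a\<bar>"
  have b: "b > 0" using False by (simp add: b_def)
  have "has_bochner_integral lborel (\<lambda>u. cos_kernel p (0 + b * u)) (integral\<^sup>L lborel (cos_kernel p) /\<^sub>R \<bar>b\<bar>)"
    using b has_bochner_integral_integrable[OF integrable_cos_kernel[OF p]]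
    by (subst lborel_has_bochner_integral_real_affine_iff[symmetric]) auto
  then have "has_bochner_integral lborel (\<lambda>u. b powr (p + 1) * cos_kernel p (b * u))
      (b powr (p + 1) * (integral\<^sup>L lborel (cos_kernel p) / b))"
    using b by (intro has_bochner_integral_mult_right) (simp add: divide_inverse mult.commute)
  also have "(\<lambda>u. b powr (p + 1) * cos_kernel p (b * u))
      = (\<lambda>u. indicator {0<..} u * u powr (- p - 1) * (1 - cos (u * a)))"
  proof
    fix u :: real
    have "cos (b * u) = cos (u * a)"
      by (cases "a \<ge> 0") (simp_all add: b_def mult.commute)
    moreover have "b powr (p + 1) * (b * u) powr (- p - 1) = u powr (- p - 1)" if "u > 0"
      using b that by (simp add: powr_mult flip: powr_add mult.assoc)
    ultimately show "b powr (p + 1) * cos_kernel p (b * u)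
        = indicator {0<..} u * u powr (- p - 1) * (1 - cos (u * a))"
      using b by (auto simp: cos_kernel_def indicator_def zero_less_mult_iff mult_ac)
  qed
  also have "b powr (p + 1) * (integral\<^sup>L lborel (cos_kernel p) / b)
      = integral\<^sup>L lborel (cos_kernel p) * \<bar>a\<bar> powr p"
    using b by (simp add: powr_add b_def)
  finally show ?thesis .
qed (simp add: has_bochner_integral_zero)

text \<open>The constant and the exponent in \<open>short_edges\<close> are those of the case \<open>r = 2\<close>, because the inequality
  is obtained by integrating that case.\<close>
lemma scalar_cotype_less2:
  assumes p: "0 < p" "p < 2"
  shows "long_edges n K L (\<lambda>x y. \<bar>g x - g y\<bar> powr p)
         \<le> 3 * short_edges 2 n K L (\<lambda>x y. \<bar>g x - g y\<bar> powr p)"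
proof -
  define c where "c = integral\<^sup>L lborel (cos_kernel p)"
  define w where "w u = indicator {0<..} u * u powr (- p - 1)" for u :: real
  have "long_edges n K L (\<lambda>x y. c * \<bar>g x - g y\<bar> powr p)
        \<le> 3 * short_edges 2 n K L (\<lambda>x y. c * \<bar>g x - g y\<bar> powr p)"
  proof (rule edges_inequality_integral)
    show "has_bochner_integral lborel (\<lambda>u. w u * (1 - cos (u * (g x - g y))))
            (c * \<bar>g x - g y\<bar> powr p)" for x y
      using has_bochner_integral_one_minus_cos[OF p] by (simp add: w_def c_def)
    fix u :: real
    define C where "C = (\<lambda>x y. \<bar>cos (u * g x) - cos (u * g y)\<bar> powr 2)"
    define S where "S = (\<lambda>x y. \<bar>sin (u * g x) - sin (u * g y)\<bar> powr 2)"
    have split: "(\<lambda>x y. w u * (1 - cos (u * (g x - g y)))) = (\<lambda>x y. w u / 2 * (C x y + S x y))"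
    proof (intro ext)
      fix x y
      have "C x y + S x y = 2 - 2 * cos (u * (g x - g y))"
        using sin_cos_squared_add[of "u * g x"] sin_cos_squared_add[of "u * g y"]
        by (simp add: C_def S_def powr_numeral power2_eq_square cos_diff right_diff_distrib
            left_diff_distrib algebra_simps)
      then show "w u * (1 - cos (u * (g x - g y))) = w u / 2 * (C x y + S x y)"
        by simp
    qed
    have "long_edges n K L C \<le> 3 * short_edges 2 n K L C"
      unfolding C_def using scalar_cotype_ge2[of 2 n K L "\<lambda>x. cos (u * g x)"] by simp
    moreover have "long_edges n K L S \<le> 3 * short_edges 2 n K L S"
      unfolding S_def using scalar_cotype_ge2[of 2 n K L "\<lambda>x. sin (u * g x)"] by simp
    ultimately have "w u / 2 * (long_edges n K L C + long_edges n K L S)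
        \<le> w u / 2 * (3 * (short_edges 2 n K L C + short_edges 2 n K L S))"
      by (intro mult_left_mono) (auto simp: w_def)
    then show "long_edges n K L (\<lambda>x y. w u * (1 - cos (u * (g x - g y))))
        \<le> 3 * short_edges 2 n K L (\<lambda>x y. w u * (1 - cos (u * (g x - g y))))"
      unfolding split long_edges_scale short_edges_scale long_edges_add short_edges_add
      by (simp only: mult_ac)
  qed
  moreover have "c > 0"
    using integral_cos_kernel_pos[OF p] by (simp add: c_def)
  ultimately show ?thesis
    by (simp add: long_edges_scale short_edges_scale mult.left_commute[of 3 c])
qed

section \<open>Metric cotype of Lebesgue spaces\<close>

lemma metric_cotype_Lp:
  fixes F :: "(nat \<Rightarrow> int) \<Rightarrow> 'a \<Rightarrow> real"
  assumes p: "p > 0" and r: "r = max 2 p"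
    and int: "\<And>x y. integrable M (\<lambda>s. \<bar>F x s - F y s\<bar> powr p)"
  shows "long_edges n K L (\<lambda>x y. \<integral>s. \<bar>F x s - F y s\<bar> powr p \<partial>M)
         \<le> 3 powr (r - 1) * short_edges r n K L (\<lambda>x y. \<integral>s. \<bar>F x s - F y s\<bar> powr p \<partial>M)"
proof (rule edges_inequality_integral)
  show "has_bochner_integral M (\<lambda>s. \<bar>F x s - F y s\<bar> powr p) (\<integral>s. \<bar>F x s - F y s\<bar> powr p \<partial>M)" for x y
    by (rule has_bochner_integral_integrable[OF int])
  show "long_edges n K L (\<lambda>x y. \<bar>F x s - F y s\<bar> powr p)
      \<le> 3 powr (r - 1) * short_edges r n K L (\<lambda>x y. \<bar>F x s - F y s\<bar> powr p)" for s
  proof (cases "p < 2")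
    case True
    then show ?thesis
      using scalar_cotype_less2[of p n K L "\<lambda>x. F x s"] p r by simp
  next
    case False
    then show ?thesis
      using scalar_cotype_ge2[of p n K L "\<lambda>x. F x s"] r by simp
  qed
qed

lemma long_edges_ge:
  assumes "\<And>j x. j < n \<Longrightarrow> \<delta> \<le> \<Phi> (jump j (2 * int K) x) x"
  shows "real n * real L ^ n * \<delta> \<le> long_edges n K L \<Phi>"
proof -
  have "real n * real L ^ n * \<delta> = (\<Sum>j<n. \<Sum>x\<in>box n L. \<delta>)"
    by (simp add: card_box)
  also have "\<dots> \<le> long_edges n K L \<Phi>"
    unfolding long_edges_def by (intro sum_mono assms) auto
  finally show ?thesis .
qed

lemma short_edges_le:
  assumes "\<And>v x. (\<And>i. \<bar>v i\<bar> \<le> 1) \<Longrightarrow> \<Phi> (shift x v) x \<le> \<omega>"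
  shows "short_edges r n K L \<Phi>
         \<le> (2 * real n * real L ^ n + (2 * real K) powr r * real (L + 2 * K) ^ n) * \<omega>"
proof -
  have sign: "\<Phi> (shift x (sign_vector n S)) x \<le> \<omega>" for x S
    by (rule assms) (auto simp: sign_vector_def)
  have punctured: "\<Phi> (shift x (punctured_sign n j S)) x \<le> \<omega>" for x j S
    by (rule assms) (auto simp: sign_vector_def punctured_sign_def)
  have "short_edges r n K L \<Phi> \<le>
      (\<Sum>j<n. \<Sum>x\<in>box n L. \<Sum>S\<in>Pow {..<n}. (\<omega> + \<omega>) / 2 ^ n)
      + (2 * real K) powr r * (\<Sum>x\<in>box n (L + 2 * K). \<Sum>S\<in>Pow {..<n}. \<omega> / 2 ^ n)"
    unfolding short_edges_def
    by (intro add_mono sum_mono mult_left_mono divide_right_mono sign punctured) auto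
  also have "\<dots> = (2 * real n * real L ^ n + (2 * real K) powr r * real (L + 2 * K) ^ n) * \<omega>"
    by (simp add: card_Pow card_box algebra_simps)
  finally show ?thesis .
qed


section \<open>Uniformly continuous maps into Lebesgue spaces\<close>

definition lq_dist :: "real \<Rightarrow> nat \<Rightarrow> (nat \<Rightarrow> real) \<Rightarrow> (nat \<Rightarrow> real) \<Rightarrow> real" where
  "lq_dist q n a b = (\<Sum>i<n. \<bar>a i - b i\<bar> powr q) powr (1 / q)"

lemma lq_dist_scaled_jump:
  assumes "q > 0" "j < n" "K > 0" "t > 0"
  shows "lq_dist q n (\<lambda>i. t / (2 * real K) * jump j (2 * int K) x i) (\<lambda>i. t / (2 * real K) * x i) = t"
proof -
  have "(\<Sum>i<n. \<bar>t / (2 * real K) * jump j (2 * int K) x i - t / (2 * real K) * x i\<bar> powr q)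
      = (\<Sum>i<n. \<bar>t / (2 * real K) * real_of_int (jump j (2 * int K) x i - x i)\<bar> powr q)"
    by (simp add: right_diff_distrib)
  also have "\<dots> = (\<Sum>i<n. if i = j then t powr q else 0)"
    using assms by (intro sum.cong) (auto simp: jump_def)
  finally show ?thesis
    using assms by (simp add: lq_dist_def powr_powr)
qed

lemma lq_dist_scaled_shift:
  fixes h :: real
  assumes "q > 0" "h > 0" and v: "\<And>i. \<bar>v i\<bar> \<le> 1"
  shows "lq_dist q n (\<lambda>i. h * shift x v i) (\<lambda>i. h * x i) \<le> h * real n powr (1 / q)"
proof -
  have "(\<Sum>i<n. \<bar>h * shift x v i - h * x i\<bar> powr q) \<le> (\<Sum>i<n. h powr q)"
  proof (rule sum_mono)
    fix i
    have "\<bar>h * shift x v i - h * x i\<bar> = h * real_of_int \<bar>v i\<bar>"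
      using assms by (simp add: shift_def algebra_simps abs_mult)
    also have "\<dots> \<le> h * 1"
      using v[of i] assms by (intro mult_left_mono) linarith+
    finally show "\<bar>h * shift x v i - h * x i\<bar> powr q \<le> h powr q"
      using assms by (intro powr_mono2) auto
  qed
  then have "lq_dist q n (\<lambda>i. h * shift x v i) (\<lambda>i. h * x i) \<le> (real n * h powr q) powr (1 / q)"
    unfolding lq_dist_def using assms by (intro powr_mono2) (auto intro: sum_nonneg)
  also have "\<dots> = h * real n powr (1 / q)"
    using assms by (simp add: powr_mult powr_powr)
  finally show ?thesis .
qed

text \<open>Here \<open>r < q\<close> enters: with \<open>n\<close> about \<open>K powr r\<close>, short edges have length of order
  \<open>K powr (r / q - 1)\<close>.\<close>
lemma short_steps_vanish:
  assumes "0 < r" "r < q" "t > 0" "d > 0"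
  obtains K :: nat where "K > 0"
    "t / (2 * real K) * real (nat \<lceil>real K powr r\<rceil>) powr (1 / q) < d"
proof -
  have "(\<lambda>K. t / 2 * 2 powr (1 / q) * real K powr (r / q - 1)) \<longlonglongrightarrow> t / 2 * 2 powr (1 / q) * 0"
    using assms
    by (intro tendsto_mult tendsto_const tendsto_neg_powr filterlim_real_sequentially)
       (auto simp: field_simps)
  then have "\<forall>\<^sub>F K in sequentially. t / 2 * 2 powr (1 / q) * real K powr (r / q - 1) < d"
    using assms by (intro order_tendstoD(2)) auto
  then have "\<forall>\<^sub>F K in sequentially. K > 0 \<and> t / 2 * 2 powr (1 / q) * real K powr (r / q - 1) < d"
    using eventually_gt_at_top[of 0] by eventually_elim auto
  then obtain K :: nat where K: "K > 0" "t / 2 * 2 powr (1 / q) * real K powr (r / q - 1) < d"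
    by (auto simp: eventually_sequentially)
  have "1 \<le> real K powr r"
    using K assms by (intro ge_one_powr_ge_zero) auto
  moreover from this have "real (nat \<lceil>real K powr r\<rceil>) \<le> 2 * real K powr r"
    by linarith
  ultimately have "real (nat \<lceil>real K powr r\<rceil>) powr (1 / q) \<le> (2 * real K powr r) powr (1 / q)"
    using assms by (intro powr_mono2) simp_all
  also have "\<dots> = 2 powr (1 / q) * real K powr (r / q)"
    by (simp add: powr_mult powr_powr)
  finally have "t / (2 * real K) * real (nat \<lceil>real K powr r\<rceil>) powr (1 / q)
      \<le> t / (2 * real K) * (2 powr (1 / q) * real K powr (r / q))"
    using assms by (intro mult_left_mono) auto
  also have "\<dots> = t / 2 * 2 powr (1 / q) * real K powr (r / q - 1)"
    using K by (simp add: powr_diff)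
  also note K(2)
  finally show ?thesis using K(1) that by blast
qed

text \<open>The choice \<open>L = 2Kn\<close> keeps the larger box comparable with the smaller one: the ratio of their sizes is
  \<open>(1 + 1/n) ^ n \<le> exp 1 \<le> 3\<close>.  The choice \<open>n \<ge> K powr r\<close> absorbs the factor \<open>(2K) powr r\<close>.\<close>
lemma cotype_constant_bound:
  assumes n: "real n \<ge> real K powr r" "K > 0" "n > 0" and \<omega>: "\<omega> \<ge> 0"
    and le: "real n * real (2 * K * n) ^ n * \<delta> \<le> c * ((2 * real n * real (2 * K * n) ^ n
               + (2 * real K) powr r * real (2 * K * n + 2 * K) ^ n) * \<omega>)"
    and c: "c \<ge> 0"
  shows "\<delta> \<le> c * (2 + 3 * 2 powr r) * \<omega>"
proof -
  define V where "V = real (2 * K * n) ^ n"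
  have V: "V > 0" using n by (simp add: V_def)
  have "real (2 * K * n + 2 * K) ^ n = V * (1 + 1 / real n) ^ n"
    unfolding V_def using n by (simp add: field_simps flip: power_mult_distrib)
  also have "(1 + 1 / real n) ^ n \<le> exp (1 / real n) ^ n"
    by (intro power_mono exp_ge_add_one_self) auto
  also have "exp (1 / real n) ^ n = exp 1"
    using n by (simp flip: exp_of_nat_mult)
  also have "exp 1 \<le> (3::real)" by (rule exp_le)
  finally have big: "real (2 * K * n + 2 * K) ^ n \<le> 3 * V"
    using V by (simp add: mult.commute)
  have "(2 * real K) powr r \<le> 2 powr r * real n"
    using n by (simp add: powr_mult)
  then have "(2 * real K) powr r * real (2 * K * n + 2 * K) ^ n \<le> (2 powr r * real n) * (3 * V)"
    using big by (intro mult_mono) auto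
  then have "2 * real n * V + (2 * real K) powr r * real (2 * K * n + 2 * K) ^ n
      \<le> real n * V * (2 + 3 * 2 powr r)"
    by (simp add: algebra_simps)
  then have "c * ((2 * real n * V + (2 * real K) powr r * real (2 * K * n + 2 * K) ^ n) * \<omega>)
      \<le> c * ((real n * V * (2 + 3 * 2 powr r)) * \<omega>)"
    using \<omega> c by (intro mult_left_mono mult_right_mono)
  with le[folded V_def] have "real n * V * \<delta> \<le> c * ((real n * V * (2 + 3 * 2 powr r)) * \<omega>)"
    by (rule order_trans)
  also have "\<dots> = (real n * V) * (c * (2 + 3 * 2 powr r) * \<omega>)"
    by (simp only: mult_ac)
  finally have "(real n * V) * \<delta> \<le> (real n * V) * (c * (2 + 3 * 2 powr r) * \<omega>)" .
  then show ?thesis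
    using V n by (simp add: mult_le_cancel_left_pos)
qed

text \<open>The map is given through its composition with parametrisations of \<open>n\<close>-dimensional pieces of the domain,
  one for each \<open>n\<close>, and through representing functions of its values; uniform continuity must hold
  uniformly in \<open>n\<close>.  In this form the sequence spaces and the function spaces are treated together.\<close>
theorem equidistant_pair_with_close_images:
  fixes F :: "nat \<Rightarrow> (nat \<Rightarrow> real) \<Rightarrow> 'a \<Rightarrow> real"
  assumes p: "p > 0" and q: "q > max 2 p"
    and int: "\<And>n a b. integrable M (\<lambda>s. \<bar>F n a s - F n b s\<bar> powr p)"
    and unif: "\<And>\<epsilon>. \<epsilon> > 0 \<Longrightarrow> \<exists>d>0. \<forall>n a b. lq_dist q n a b < d \<longrightarrow>
                 (\<integral>s. \<bar>F n a s - F n b s\<bar> powr p \<partial>M) powr (1 / p) < \<epsilon>"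
    and t: "t > 0" and e: "e > 0"
  shows "\<exists>n a b. lq_dist q n a b = t \<and>
    (\<integral>s. \<bar>F n a s - F n b s\<bar> powr p \<partial>M) powr (1 / p) < e"
proof (rule ccontr)
  assume none: "\<not> ?thesis"
  then have far: "e \<le> (\<integral>s. \<bar>F n a s - F n b s\<bar> powr p \<partial>M) powr (1 / p)" if "lq_dist q n a b = t" for n a b
    using none that not_le_imp_less by blast
  define r where "r = max 2 p"
  define C where "C = 3 powr (r - 1) * (2 + 3 * 2 powr r)"
  have C: "C > 0" by (simp add: C_def add_pos_nonneg)
  \<comment> \<open>Chosen so that the cotype inequality yields \<open>e powr p \<le> e powr p / 2\<close>.\<close>
  define \<epsilon> where "\<epsilon> = e / (2 * C) powr (1 / p)"
  have \<epsilon>: "\<epsilon> > 0" "\<epsilon> powr p = e powr p / (2 * C)"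
    using e C p by (simp_all add: \<epsilon>_def powr_divide powr_powr)
  obtain d where d: "d > 0" and near: "\<And>n a b. lq_dist q n a b < d \<Longrightarrow>
      (\<integral>s. \<bar>F n a s - F n b s\<bar> powr p \<partial>M) powr (1 / p) < \<epsilon>"
    using unif[OF \<epsilon>(1)] by blast
  have r: "0 < r" "r < q" using q by (auto simp: r_def)
  obtain K :: nat where K: "K > 0"
    and Kd: "t / (2 * real K) * real (nat \<lceil>real K powr r\<rceil>) powr (1 / q) < d"
    using short_steps_vanish[OF r t d] by blast
  define n where "n = nat \<lceil>real K powr r\<rceil>"
  have Kr: "real K powr r > 0" using K by simp
  have n: "real n \<ge> real K powr r" "n > 0"
    using Kr unfolding n_def by linarith+
  define u where "u x = (\<lambda>i. t / (2 * real K) * real_of_int (x i))" for x :: "nat \<Rightarrow> int"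
  define \<Phi> where "\<Phi> x y = (\<integral>s. \<bar>F n (u x) s - F n (u y) s\<bar> powr p \<partial>M)" for x y
  have root: "(\<Phi> x y powr (1 / p)) powr p = \<Phi> x y" for x y
    using p by (simp add: powr_powr \<Phi>_def)
  have long: "e powr p \<le> \<Phi> (jump j (2 * int K) x) x" if "j < n" for j x
  proof -
    have "lq_dist q n (u (jump j (2 * int K) x)) (u x) = t"
      unfolding u_def using lq_dist_scaled_jump[OF _ that K t] r by simp
    then have "e \<le> \<Phi> (jump j (2 * int K) x) x powr (1 / p)"
      unfolding \<Phi>_def by (rule far)
    then have "e powr p \<le> (\<Phi> (jump j (2 * int K) x) x powr (1 / p)) powr p"
      using e p by (intro powr_mono2) auto
    then show ?thesis by (simp only: root)
  qed
  have short: "\<Phi> (shift x v) x \<le> \<epsilon> powr p" if "\<And>i. \<bar>v i\<bar> \<le> 1" for x v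
  proof -
    have "lq_dist q n (u (shift x v)) (u x) \<le> t / (2 * real K) * real n powr (1 / q)"
      unfolding u_def using r t K by (intro lq_dist_scaled_shift that) auto
    then have "\<Phi> (shift x v) x powr (1 / p) < \<epsilon>"
      unfolding \<Phi>_def using Kd by (intro near) (simp add: n_def)
    then have "(\<Phi> (shift x v) x powr (1 / p)) powr p \<le> \<epsilon> powr p"
      using p by (intro powr_mono2) auto
    then show ?thesis by (simp only: root)
  qed
  let ?L = "2 * K * n"
  have "real n * real ?L ^ n * (e powr p) \<le> long_edges n K ?L \<Phi>"
    by (intro long_edges_ge long)
  also have "\<dots> \<le> 3 powr (r - 1) * short_edges r n K ?L \<Phi>"
    unfolding \<Phi>_def by (rule metric_cotype_Lp[OF p r_def int])
  also have "\<dots> \<le> 3 powr (r - 1) * ((2 * real n * real ?L ^ n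
               + (2 * real K) powr r * real (?L + 2 * K) ^ n) * \<epsilon> powr p)"
    by (intro mult_left_mono short_edges_le short) auto
  finally have "e powr p \<le> C * (\<epsilon> powr p)"
    unfolding C_def by (intro cotype_constant_bound[OF n(1) K n(2)]) auto
  also have "\<dots> = e powr p / 2"
    using C by (simp add: \<epsilon>(2))
  finally show False using e by simp
qed


section \<open>Sequence spaces and Lebesgue spaces as domain and range\<close>

lemma SUP_INF_dist_eq_0:
  fixes N :: "'x \<Rightarrow> 'x \<Rightarrow> real" and D :: "'x \<Rightarrow> 'x \<Rightarrow> real"
  assumes nonneg: "\<And>x y. 0 \<le> D x y"
    and close: "\<And>t e. t > 0 \<Longrightarrow> e > 0 \<Longrightarrow> \<exists>x\<in>A. \<exists>y\<in>A. N x y = t \<and> D x y < e"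
  shows "(SUP t\<in>{0<..}. INF (x, y)\<in>{(x, y). x \<in> A \<and> y \<in> A \<and> N x y = t}. ereal (D x y)) = 0"
proof -
  have "(INF (x, y)\<in>{(x, y). x \<in> A \<and> y \<in> A \<and> N x y = t}. ereal (D x y)) = 0" if t: "t > 0" for t
  proof (rule antisym)
    show "(INF (x, y)\<in>{(x, y). x \<in> A \<and> y \<in> A \<and> N x y = t}. ereal (D x y)) \<le> 0"
    proof (rule ereal_le_epsilon2)
      fix e :: real assume "e > 0"
      then obtain x y where "x \<in> A" "y \<in> A" "N x y = t" "D x y < e"
        using close[OF t] by blast
      then show "(INF (x, y)\<in>{(x, y). x \<in> A \<and> y \<in> A \<and> N x y = t}. ereal (D x y)) \<le> 0 + ereal e"
        by (intro INF_lower2[of "(x, y)"]) auto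
    qed
  qed (auto intro!: INF_greatest simp: nonneg)
  then have "(SUP t\<in>{0<..}. INF (x, y)\<in>{(x, y). x \<in> A \<and> y \<in> A \<and> N x y = t}. ereal (D x y))
      = (SUP t\<in>{0::real<..}. 0)"
    by (intro SUP_cong) auto
  then show ?thesis by simp
qed

definition pad :: "nat \<Rightarrow> (nat \<Rightarrow> real) \<Rightarrow> nat \<Rightarrow> real" where
  "pad n a i = (if i < n then a i else 0)"

lemma pad_in_lp_space: "pad n a \<in> lp_space q"
  by (simp add: lp_space_def, rule summable_finite[of "{..<n}"]) (auto simp: pad_def)

lemma lp_norm_pad: "lp_norm q (pad n a - pad n b) = lq_dist q n a b"
proof -
  have "(\<Sum>i. \<bar>(pad n a - pad n b) i\<bar> powr q) = (\<Sum>i<n. \<bar>(pad n a - pad n b) i\<bar> powr q)"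
    by (rule suminf_finite) (auto simp: pad_def)
  then show ?thesis
    by (simp add: lp_norm_def lq_dist_def pad_def)
qed

text \<open>An isometric copy of the \<open>n\<close>-dimensional \<open>q\<close>-norm in the Lebesgue space: step functions on \<open>n\<close> disjoint
  intervals of length \<open>1/n\<close>, with heights multiplied by \<open>n powr (1/q)\<close>.\<close>
definition piece :: "nat \<Rightarrow> nat \<Rightarrow> real set" where
  "piece n i = {real i / real n..<real (Suc i) / real n}"

lemma disjoint_pieces: "s \<in> piece n i \<Longrightarrow> s \<in> piece n j \<Longrightarrow> i = j"
proof -
  assume "s \<in> piece n i" "s \<in> piece n j"
  moreover from this have "n > 0" by (auto simp: piece_def intro!: gr0I)
  ultimately have "real i < real (Suc j)" "real j < real (Suc i)"
    unfolding piece_def by (simp_all add: divide_le_eq less_divide_eq)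
  then show "i = j" by simp
qed

lemma piece_subset: "i < n \<Longrightarrow> piece n i \<subseteq> {0..1}"
proof
  fix s assume "i < n" "s \<in> piece n i"
  then have "real i / real n \<le> s" "s < real (Suc i) / real n" "real (Suc i) / real n \<le> 1"
    by (auto simp: piece_def)
  moreover have "0 \<le> real i / real n" by simp
  ultimately show "s \<in> {0..1}" unfolding atLeastAtMost_iff by linarith
qed

lemma has_bochner_integral_piece:
  assumes "i < n"
  shows "has_bochner_integral I01 (indicator (piece n i)) (1 / real n)"
proof -
  have "emeasure I01 (piece n i) = emeasure lborel (piece n i)"
    using piece_subset[OF assms] by (subst emeasure_restrict_space) (auto simp: piece_def)
  also have "\<dots> = ennreal (1 / real n)"
    using assms by (simp add: piece_def diff_divide_distrib[symmetric] divide_right_mono)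
  finally have "emeasure I01 (piece n i) = ennreal (1 / real n)" .
  moreover have "piece n i \<in> sets I01"
    using piece_subset[OF assms] by (auto simp: sets_restrict_space piece_def)
  ultimately show ?thesis
    using has_bochner_integral_real_indicator[of "piece n i" I01] by (simp add: measure_def)
qed

definition step_function :: "nat \<Rightarrow> (nat \<Rightarrow> real) \<Rightarrow> real \<Rightarrow> real" where
  "step_function n c s = (\<Sum>i<n. c i * indicator (piece n i) s)"

lemma borel_measurable_step_function [measurable]: "step_function n c \<in> borel_measurable I01"
proof -
  have "step_function n c \<in> borel_measurable borel"
    unfolding step_function_def piece_def by measurable
  then show ?thesis
    by (intro measurable_restrict_space1 measurable_completion) simp
qed

text \<open>At most one summand is nonzero at any point, as the intervals are disjoint.\<close>
lemma abs_step_function_powr: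
  "\<bar>step_function n c s\<bar> powr q = (\<Sum>i<n. \<bar>c i\<bar> powr q * indicator (piece n i) s)"
proof (cases "\<exists>j<n. s \<in> piece n j")
  case True
  then obtain j where j: "j < n" "s \<in> piece n j" by blast
  then have "indicator (piece n i) s = (if i = j then 1 else 0 :: real)" for i
    using disjoint_pieces by (auto simp: indicator_def)
  then show ?thesis using j by (simp add: step_function_def if_distrib[of "(*) _"] cong: if_cong)
next
  case False
  then show ?thesis by (simp add: step_function_def)
qed

lemma has_bochner_integral_step_function:
  "has_bochner_integral I01 (\<lambda>s. \<bar>step_function n c s\<bar> powr q) ((\<Sum>i<n. \<bar>c i\<bar> powr q) / real n)"
  unfolding abs_step_function_powr sum_divide_distrib
proof (rule has_bochner_integral_sum)
  fix i assume "i \<in> {..<n}"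
  then show "has_bochner_integral I01 (\<lambda>s. \<bar>c i\<bar> powr q * indicator (piece n i) s) (\<bar>c i\<bar> powr q / real n)"
    using has_bochner_integral_mult_right[OF has_bochner_integral_piece[of i n], where c = "\<bar>c i\<bar> powr q"] by simp
qed

lift_definition step_class :: "nat \<Rightarrow> (nat \<Rightarrow> real) \<Rightarrow> ae_fun" is step_function
  by simp

lemma step_class_in_Lp_space: "step_class n c \<in> Lp_space q"
  unfolding Lp_space_def mem_Collect_eq
  by transfer (rule integrable.intros[OF has_bochner_integral_step_function])

lemma step_function_diff:
  "step_function n a s - step_function n b s = step_function n (\<lambda>i. a i - b i) s"
  by (simp add: step_function_def left_diff_distrib sum_subtractf)

lemma step_class_diff: "step_class n a - step_class n b = step_class n (\<lambda>i. a i - b i)"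
  by transfer (simp add: step_function_diff)

lemma Lp_norm_step_class: "Lp_norm q (step_class n c) = ((\<Sum>i<n. \<bar>c i\<bar> powr q) / real n) powr (1 / q)"
  by transfer (simp add: has_bochner_integral_integral_eq[OF has_bochner_integral_step_function])

lemma Lp_norm_scaled_step_class:
  assumes "q > 0"
  shows "Lp_norm q (step_class n (\<lambda>i. real n powr (1 / q) * a i) - step_class n (\<lambda>i. real n powr (1 / q) * b i))
         = lq_dist q n a b"
proof -
  have scale: "\<bar>real n powr (1 / q) * a i - real n powr (1 / q) * b i\<bar> powr q = real n * \<bar>a i - b i\<bar> powr q" for i
  proof -
    have "\<bar>real n powr (1 / q) * a i - real n powr (1 / q) * b i\<bar> = real n powr (1 / q) * \<bar>a i - b i\<bar>"
      by (simp add: abs_mult flip: right_diff_distrib)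
    then show ?thesis
      using assms by (simp add: powr_mult powr_powr)
  qed
  have "(\<Sum>i<n. \<bar>real n powr (1 / q) * a i - real n powr (1 / q) * b i\<bar> powr q) / real n
      = (\<Sum>i<n. \<bar>a i - b i\<bar> powr q)"
    unfolding scale sum_distrib_left[symmetric] by (cases "n = 0") auto
  then show ?thesis
    by (simp only: step_class_diff Lp_norm_step_class lq_dist_def)
qed

lemma rep_ae_fun_borel_measurable: "rep_ae_fun F \<in> borel_measurable I01"
  using Quotient_rep_reflp[OF Quotient_ae_fun] by simp

lemma Lp_norm_diff_rep:
  "Lp_norm p (F - G) = (\<integral>s. \<bar>rep_ae_fun F s - rep_ae_fun G s\<bar> powr p \<partial>I01) powr (1 / p)"
proof -
  have "F - G = abs_ae_fun (\<lambda>s. rep_ae_fun F s - rep_ae_fun G s)"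
    by (simp add: minus_ae_fun_def)
  then show ?thesis
    using rep_ae_fun_borel_measurable by (simp add: Lp_norm.abs_eq)
qed

lemma in_Lp_diff_rep:
  "F - G \<in> Lp_space p \<longleftrightarrow> integrable I01 (\<lambda>s. \<bar>rep_ae_fun F s - rep_ae_fun G s\<bar> powr p)"
proof -
  have "F - G = abs_ae_fun (\<lambda>s. rep_ae_fun F s - rep_ae_fun G s)"
    by (simp add: minus_ae_fun_def)
  then show ?thesis
    using rep_ae_fun_borel_measurable by (simp add: Lp_space_def in_Lp.abs_eq)
qed

text \<open>The same statement for a map between metric spaces, where \<open>u n\<close> embeds the \<open>n\<close>-dimensional \<open>q\<close>-norm
  isometrically into the domain and \<open>rep\<close> represents the target isometrically by functions.\<close>
lemma equidistant_close_images_metric: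
  fixes f :: "'x \<Rightarrow> 'y" and u :: "nat \<Rightarrow> (nat \<Rightarrow> real) \<Rightarrow> 'x" and rep :: "'y \<Rightarrow> 'a \<Rightarrow> real"
  assumes p: "p > 0" and q: "q > max 2 p"
    and f: "uniformly_continuous_map X Y f"
    and u: "\<And>n a. u n a \<in> mspace X"
    and u_dist: "\<And>n a b. mdist X (u n a) (u n b) = lq_dist q n a b"
    and rep_int: "\<And>y z. y \<in> mspace Y \<Longrightarrow> z \<in> mspace Y \<Longrightarrow> integrable M (\<lambda>s. \<bar>rep y s - rep z s\<bar> powr p)"
    and rep_dist: "\<And>y z. y \<in> mspace Y \<Longrightarrow> z \<in> mspace Y \<Longrightarrow>
          mdist Y y z = (\<integral>s. \<bar>rep y s - rep z s\<bar> powr p \<partial>M) powr (1 / p)"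
    and t: "t > 0" and e: "e > 0"
  shows "\<exists>x\<in>mspace X. \<exists>y\<in>mspace X. mdist X x y = t \<and> mdist Y (f x) (f y) < e"
proof -
  have fu: "f (u n a) \<in> mspace Y" for n a
    using f u by (auto simp: uniformly_continuous_map_def)
  have "\<exists>n a b. lq_dist q n a b = t \<and>
      (\<integral>s. \<bar>rep (f (u n a)) s - rep (f (u n b)) s\<bar> powr p \<partial>M) powr (1 / p) < e"
  proof (rule equidistant_pair_with_close_images[OF p q _ _ t e])
    show "integrable M (\<lambda>s. \<bar>rep (f (u n a)) s - rep (f (u n b)) s\<bar> powr p)" for n a b
      by (intro rep_int fu)
    fix \<epsilon> :: real assume "\<epsilon> > 0"
    then obtain d where "d > 0" and d: "\<And>x y. x \<in> mspace X \<Longrightarrow> y \<in> mspace X \<Longrightarrow> mdist X y x < d \<Longrightarrow> mdist Y (f y) (f x) < \<epsilon>"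
      using f unfolding uniformly_continuous_map_def by metis
    then show "\<exists>d>0. \<forall>n a b. lq_dist q n a b < d \<longrightarrow>
        (\<integral>s. \<bar>rep (f (u n a)) s - rep (f (u n b)) s\<bar> powr p \<partial>M) powr (1 / p) < \<epsilon>"
      unfolding u_dist[symmetric] rep_dist[OF fu fu, symmetric]
      using d[OF u u] by (simp only: mdist_commute) blast
  qed
  then show ?thesis
    unfolding u_dist[symmetric] rep_dist[OF fu fu, symmetric] using u by blast
qed

theorem corollary1p4:
  fixes p q :: real
  assumes "1 \<le> p" and "1 \<le> q" and "q > max 2 p"
  shows "(\<forall>f. uniformly_continuous_map (lp_metric q) (lp_metric p) f \<longrightarrow>
            (SUP t\<in>{0<..}. INF (x, y)\<in>{(x, y). x \<in> lp_space q \<and> y \<in> lp_space q \<and> lp_norm q (x - y) = t}.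
               ereal (lp_norm p (f x - f y))) = 0) \<and>
         (\<forall>f. uniformly_continuous_map (Lp_metric q) (Lp_metric p) f \<longrightarrow>
            (SUP t\<in>{0<..}. INF (x, y)\<in>{(x, y). x \<in> Lp_space q \<and> y \<in> Lp_space q \<and> Lp_norm q (x - y) = t}.
               ereal (Lp_norm p (f x - f y))) = 0)"
proof (intro conjI allI impI)
  fix f assume f: "uniformly_continuous_map (lp_metric q) (lp_metric p) f"
  show "(SUP t\<in>{0<..}. INF (x, y)\<in>{(x, y). x \<in> lp_space q \<and> y \<in> lp_space q \<and> lp_norm q (x - y) = t}.
               ereal (lp_norm p (f x - f y))) = 0"
  proof (rule SUP_INF_dist_eq_0)
    fix t e :: real assume te: "t > 0" "e > 0"
    have "\<exists>x\<in>mspace (lp_metric q). \<exists>y\<in>mspace (lp_metric q).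
        mdist (lp_metric q) x y = t \<and> mdist (lp_metric p) (f x) (f y) < e"
    proof (rule equidistant_close_images_metric[OF _ assms(3) f, where u = pad and rep = "\<lambda>y. y" and M = "count_space UNIV"])
      fix y z assume "y \<in> mspace (lp_metric p)" "z \<in> mspace (lp_metric p)"
      then have "y - z \<in> lp_space p"
        using assms by (simp add: lp_space_diff)
      then show "integrable (count_space UNIV) (\<lambda>s. \<bar>y s - z s\<bar> powr p)"
        and "mdist (lp_metric p) y z = (\<integral>s. \<bar>y s - z s\<bar> powr p \<partial>count_space UNIV) powr (1 / p)"
        using assms by (simp_all add: lp_space_integrable lp_norm_integral)
    qed (use assms te in \<open>simp_all add: pad_in_lp_space lp_norm_pad\<close>)
    then show "\<exists>x\<in>lp_space q. \<exists>y\<in>lp_space q. lp_norm q (x - y) = t \<and> lp_norm p (f x - f y) < e"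
      using assms by simp
  qed (simp add: lp_norm_def)
next
  fix f assume f: "uniformly_continuous_map (Lp_metric q) (Lp_metric p) f"
  show "(SUP t\<in>{0<..}. INF (x, y)\<in>{(x, y). x \<in> Lp_space q \<and> y \<in> Lp_space q \<and> Lp_norm q (x - y) = t}.
               ereal (Lp_norm p (f x - f y))) = 0"
  proof (rule SUP_INF_dist_eq_0)
    fix t e :: real assume te: "t > 0" "e > 0"
    have "\<exists>x\<in>mspace (Lp_metric q). \<exists>y\<in>mspace (Lp_metric q).
        mdist (Lp_metric q) x y = t \<and> mdist (Lp_metric p) (f x) (f y) < e"
    proof (rule equidistant_close_images_metric[OF _ assms(3) f,
          where u = "\<lambda>n a. step_class n (\<lambda>i. real n powr (1 / q) * a i)" and rep = rep_ae_fun and M = I01])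
      fix y z assume "y \<in> mspace (Lp_metric p)" "z \<in> mspace (Lp_metric p)"
      then have "y - z \<in> Lp_space p"
        using assms by (simp add: Lp_space_diff)
      then show "integrable I01 (\<lambda>s. \<bar>rep_ae_fun y s - rep_ae_fun z s\<bar> powr p)"
        and "mdist (Lp_metric p) y z = (\<integral>s. \<bar>rep_ae_fun y s - rep_ae_fun z s\<bar> powr p \<partial>I01) powr (1 / p)"
        using assms by (simp_all add: in_Lp_diff_rep Lp_norm_diff_rep)
    qed (use assms te in \<open>simp_all add: step_class_in_Lp_space Lp_norm_scaled_step_class\<close>)
    then show "\<exists>x\<in>Lp_space q. \<exists>y\<in>Lp_space q. Lp_norm q (x - y) = t \<and> Lp_norm p (f x - f y) < e"
      using assms by simp
  qed (simp add: Lp_norm_nonneg)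
qed

end
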